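(* Let $\mathcal{X}$ be a measurable space, $\mathcal{G}$ a separable Hilbert space, $\mathcal{Y}$ a complete subset of $\mathcal{G}$, and $\mathcal{H}$ a separable $\mathcal{G}$-valued reproducing kernel Hilbert space (RKHS) of measurable functions on $\mathcal{X}$ with bounded kernel $K$ and canonical feature map $\Phi:x\in\mathcal{X}\mapsto K(\cdot,x)\in\mathcal{L}(\mathcal{G};\mathcal{H})$. Let $L:\mathcal{X}\times\mathcal{Y}\times\mathcal{G}\to[0,\infty)$ be a convex loss function and $J$ a probability measure on $\mathcal{X}\times\mathcal{Y}$ such that $L$ is a $J$-integrable Nemitski loss of order $2$. For $\lambda>0$, let $f_{J,\lambda}\in\mathcal{H}$ be the unique minimizer over $f\in\mathcal{H}$ of $\mathcal{R}_{L,J}(f)+\lambda\lVert f\rVert^2_{\mathcal{H}}$. Then, for all $\lambda>0$, there exists $h_{J,\lambda}\in\mathcal{L}_2(\mathcal{X}\times\mathcal{Y},J;\mathcal{G})$ such that $$h_{J,\lambda}(x,y)\in\partial L(x,y,f_{J,\lambda}(x))\quad\text{for all }(x,y)\in\mathcal{X}\times\mathcal{Y},$$ $$f_{J,\lambda}=-\frac1{2\lambda}J(\Phi h_{J,\lambda}).$$ If, additionally, $L$ is locally Lipschitz continuous, then any such $h_{J,\lambda}$ satisfies $\lVert h_{J,\lambda}\rVert_\infty\le\lvert L\rvert_{B_\lambda,1}$, where $B_\lambda=\sqrt{\mathcal{R}_{L,J}(0)/\lambda}$.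
   Context: A $\mathcal{G}$-valued RKHS $\mathcal{H}$ on $\mathcal{X}$ is a Hilbert space of functions $\mathcal{X}\to\mathcal{G}$ for which every evaluation operator $S_x:f\mapsto f(x)$ is continuous; $K(\cdot,x):=S_x^\star\in\mathcal{L}(\mathcal{G};\mathcal{H})$ (bounded linear operators) and $K(x,x'):=S_xS_{x'}^\star$. $K$ is bounded if $\sup_x\sqrt{\lVert K(x,x)\rVert}<\infty$ (operator norm). A loss function is a measurable $L:\mathcal{X}\times\mathcal{Y}\times\mathcal{G}\to[0,\infty)$. It is convex if $L(x,y,\cdot)$ is convex for all $(x,y)$; it is a $J$-integrable Nemitski loss of order $2$ if there are a measurable $b:\mathcal{X}\times\mathcal{Y}\to[0,\infty)$ with $\int b\,\mathrm{d}J<\infty$ and a constant $c>0$ with $L(x,y,t)\le b(x,y)+c\lVert t\rVert_{\mathcal{G}}^2$ for all $(x,y,t)$; it is locally Lipschitz continuous if for all $a>0$, $$\lvert L\rvert_{a,1}:=\sup_{\substack{(t,t')\in\mathcal{G}^2\\0<\lVert t-t'\rVert_{\mathcal{G}}\le2a}}\ \sup_{x\in\mathcal{X},\,y\in\mathcal{Y}}\frac{\lvert L(x,y,t)-L(x,y,t')\rvert}{\lVert t-t'\rVert_{\mathcal{G}}}<\infty.$$ $\mathcal{R}_{L,J}(f)=\int_{\mathcal{X}\times\mathcal{Y}}L(x,y,f(x))\,\mathrm{d}J(x,y)$. $\mathcal{L}_2(\mathcal{X}\times\mathcal{Y},J;\mathcal{G})$ is the set of measurable functions $h:\mathcal{X}\times\mathcal{Y}\to\mathcal{G}$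 with $\int\lVert h\rVert_{\mathcal{G}}^2\,\mathrm{d}J<\infty$, and $\lVert h\rVert_\infty=\sup_{(x,y)}\lVert h(x,y)\rVert_{\mathcal{G}}$. $\Phi h$ denotes the function $(x,y)\mapsto\Phi(x)h(x,y)=K(\cdot,x)h(x,y)\in\mathcal{H}$, and $J(\Phi h)$ its (Bochner) integral with respect to $J$. $\partial L(x,y,t)\subset\mathcal{G}$ is the subdifferential of the convex function $L(x,y,\cdot)$ at $t$: the set of $v\in\mathcal{G}$ with $L(x,y,s)\ge L(x,y,t)+\langle v,s-t\rangle_{\mathcal{G}}$ for all $s\in\mathcal{G}$.
   Formalization: When the risk of 0 vanishes, so that B_λ = 0 and |L|_{B_λ,1} is undefined (an empty supremum would make the bound false), the bound is stated instead as ‖h‖∞ ≤ |L|_{a,1} for every a > 0; for B_λ > 0 the bound is as written. *)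

theory Defs
  imports "HOL-Probability.Probability_Measure"
begin

text \<open>
  Real separable Hilbert spaces are types of sort
  \<open>{real_inner, banach, second_countable_topology}\<close>; a measurable space is a \<open>measure\<close> of which
  only \<open>space\<close> and \<open>sets\<close> are used.

  A Hilbert space of functions from \<open>space MX\<close> to \<open>'g\<close> is a Hilbert space type \<open>'h\<close> together
  with an evaluation \<open>eval_h :: 'h \<Rightarrow> 'x \<Rightarrow> 'g\<close>: the element \<open>f\<close> is the function \<open>eval_h f\<close> on \<open>space MX\<close>.
  Injectivity says that \<open>f\<close> is determined by this function, and linearity of \<open>f \<mapsto> eval_h f x\<close> says that
  the vector space operations of \<open>'h\<close> are the pointwise ones.
\<close>

definition rkhs :: "'x measure \<Rightarrow> ('h::{real_inner, banach} \<Rightarrow> 'x \<Rightarrow> 'g::{real_inner, banach}) \<Rightarrow> bool"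
  where "rkhs MX eval_h \<longleftrightarrow>
    (\<forall>x\<in>space MX. bounded_linear (\<lambda>f. eval_h f x)) \<and>
    (\<forall>f g. (\<forall>x\<in>space MX. eval_h f x = eval_h g x) \<longrightarrow> f = g)"

text \<open>The adjoint of a bounded operator between Hilbert spaces exists and is unique
  (Riesz), so the choice in \<open>adjoint\<close> is determined.\<close>

definition feature_map ::
    "('h::{real_inner, banach} \<Rightarrow> 'x \<Rightarrow> 'g::{real_inner, banach}) \<Rightarrow> 'x \<Rightarrow> 'g \<Rightarrow> 'h"
  where "feature_map eval_h x = adjoint (\<lambda>f. eval_h f x)"

definition kernel ::
    "('h::{real_inner, banach} \<Rightarrow> 'x \<Rightarrow> 'g::{real_inner, banach}) \<Rightarrow> 'x \<Rightarrow> 'x \<Rightarrow> 'g \<Rightarrow> 'g"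
  where "kernel eval_h x x' = (\<lambda>f. eval_h f x) \<circ> feature_map eval_h x'"

definition bounded_kernel ::
    "'x measure \<Rightarrow> ('h::{real_inner, banach} \<Rightarrow> 'x \<Rightarrow> 'g::{real_inner, banach}) \<Rightarrow> bool"
  where "bounded_kernel MX eval_h \<longleftrightarrow> bdd_above ((\<lambda>x. sqrt (onorm (kernel eval_h x x))) ` space MX)"

definition loss_function ::
    "'x measure \<Rightarrow> 'g set \<Rightarrow> ('x \<Rightarrow> 'g \<Rightarrow> 'g::real_normed_vector \<Rightarrow> real) \<Rightarrow> bool"
  where "loss_function MX Y L \<longleftrightarrow>
    (\<lambda>(x, y, t). L x y t) \<in> borel_measurable (MX \<Otimes>\<^sub>M (restrict_space borel Y \<Otimes>\<^sub>M borel)) \<and>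
    (\<forall>x\<in>space MX. \<forall>y\<in>Y. \<forall>t. 0 \<le> L x y t)"

definition convex_loss ::
    "'x measure \<Rightarrow> 'g set \<Rightarrow> ('x \<Rightarrow> 'g \<Rightarrow> 'g::real_normed_vector \<Rightarrow> real) \<Rightarrow> bool"
  where "convex_loss MX Y L \<longleftrightarrow> (\<forall>x\<in>space MX. \<forall>y\<in>Y. convex_on UNIV (L x y))"

definition nemitski_loss2 ::
    "'x measure \<Rightarrow> 'g set \<Rightarrow> ('x \<times> 'g) measure \<Rightarrow> ('x \<Rightarrow> 'g \<Rightarrow> 'g::real_normed_vector \<Rightarrow> real) \<Rightarrow> bool"
  where "nemitski_loss2 MX Y J L \<longleftrightarrow>
    (\<exists>b c. b \<in> borel_measurable (MX \<Otimes>\<^sub>M restrict_space borel Y) \<and>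
       (\<forall>x\<in>space MX. \<forall>y\<in>Y. 0 \<le> b (x, y)) \<and> integrable J b \<and> 0 < c \<and>
       (\<forall>x\<in>space MX. \<forall>y\<in>Y. \<forall>t. L x y t \<le> b (x, y) + c * (norm t)\<^sup>2))"

text \<open>$|L|_{a,1}$ as a supremum in $[0,\infty]$; meaningful only for $a > 0$, because for $a = 0$
  the supremum is over the empty set.\<close>

definition lip_const ::
    "'x measure \<Rightarrow> 'g set \<Rightarrow> ('x \<Rightarrow> 'g \<Rightarrow> 'g::real_normed_vector \<Rightarrow> real) \<Rightarrow> real \<Rightarrow> ennreal"
  where "lip_const MX Y L a =
    (SUP (t, t') \<in> {(t, t'). 0 < norm (t - t') \<and> norm (t - t') \<le> 2 * a}.
       SUP (x, y) \<in> space MX \<times> Y. ennreal (\<bar>L x y t - L x y t'\<bar> / norm (t - t')))"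

definition locally_lipschitz_loss ::
    "'x measure \<Rightarrow> 'g set \<Rightarrow> ('x \<Rightarrow> 'g \<Rightarrow> 'g::real_normed_vector \<Rightarrow> real) \<Rightarrow> bool"
  where "locally_lipschitz_loss MX Y L \<longleftrightarrow> (\<forall>a>0. lip_const MX Y L a < \<infinity>)"

text \<open>For a Nemitski loss of order 2 with bounded kernel the integrand below is integrable for
  every \<open>f\<close> in the RKHS, so the real-valued integral is the risk and never the default value.\<close>

definition risk ::
    "('x \<Rightarrow> 'g \<Rightarrow> 'g \<Rightarrow> real) \<Rightarrow> ('x \<times> 'g) measure \<Rightarrow> ('x \<Rightarrow> 'g) \<Rightarrow> real"
  where "risk L J f = (\<integral>(x, y). L x y (f x) \<partial>J)"

definition reg_risk ::
    "('h::real_normed_vector \<Rightarrow> 'x \<Rightarrow> 'g) \<Rightarrow> ('x \<Rightarrow> 'g \<Rightarrow> 'g \<Rightarrow> real) \<Rightarrow> ('x \<times> 'g) measure \<Rightarrow> real \<Rightarrow> 'h \<Rightarrow> real"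
  where "reg_risk eval_h L J lam f = risk L J (eval_h f) + lam * (norm f)\<^sup>2"

definition reg_minimizer ::
    "('h::real_normed_vector \<Rightarrow> 'x \<Rightarrow> 'g) \<Rightarrow> ('x \<Rightarrow> 'g \<Rightarrow> 'g \<Rightarrow> real) \<Rightarrow> ('x \<times> 'g) measure \<Rightarrow> real \<Rightarrow> 'h"
  where "reg_minimizer eval_h L J lam = arg_min (reg_risk eval_h L J lam) (\<lambda>_. True)"

definition subdifferential :: "('g::real_inner \<Rightarrow> real) \<Rightarrow> 'g \<Rightarrow> 'g set"
  where "subdifferential F t = {v. \<forall>s. F s \<ge> F t + v \<bullet> (s - t)}"

definition square_integrable :: "'z measure \<Rightarrow> ('z \<Rightarrow> 'g::real_normed_vector) \<Rightarrow> bool"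
  where "square_integrable J h \<longleftrightarrow> h \<in> borel_measurable J \<and> integrable J (\<lambda>z. (norm (h z))\<^sup>2)"

definition integral_feature ::
    "('h::{real_inner, banach, second_countable_topology} \<Rightarrow> 'x \<Rightarrow> 'g::{real_inner, banach}) \<Rightarrow>
     ('x \<times> 'g) measure \<Rightarrow> ('x \<times> 'g \<Rightarrow> 'g) \<Rightarrow> 'h"
  where "integral_feature eval_h J h = (\<integral>(x, y). feature_map eval_h x (h (x, y)) \<partial>J)"

definition sup_norm :: "'z set \<Rightarrow> ('z \<Rightarrow> 'g::real_normed_vector) \<Rightarrow> ennreal"
  where "sup_norm Z h = (SUP z\<in>Z. ennreal (norm (h z)))"

end

(*
  Let y_e(z, t) be the Yosida approximation of the monotone operator dL(z, .), that is the y with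
  y in dL(z, t - e y). It is monotone and (1/e)-Lipschitz in t, so Banach's fixed point theorem gives
  f_e with 2 lambda f_e + J(Phi h_e) = 0, where h_e(x, y) = y_e((x, y), f_e(x)). Monotonicity of
  dL(z, .), integrated over J, makes the L2 norm of h_e monotone in e and yields
    ||h_e - h_d||^2 <= | ||h_e||^2 - ||h_d||^2 |.
  Hence h_e is Cauchy in L2, without any appeal to weak compactness. A subsequence converges almost
  everywhere, f_e converges with it, and the limits satisfy both conditions of the representation.
  The subgradient inequality then shows that the limit of f_e is the unique minimizer.
  Measurability of y_e holds because it is given by a minimizer over t in a separable space.
*)
theory Submission
  imports Defs
begin

section \<open>Convex functions on Hilbert spaces\<close>

text \<open>Starting from a minimizer would require a chain rule for the subdifferential of an
  integral functional together with a measurable selection of subgradients. Solving the stationarity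
  equation instead postpones the minimizer: by convexity every solution minimizes, so existence and
  uniqueness of the minimizer come out of the representation. The regularized maps have Lipschitz
  constants of order \<open>1/e\<close>, so the contraction argument says nothing as
  \<open>e\<close> tends to 0. Two bounds uniform in \<open>e\<close> take over. Quadratic growth of
  the loss bounds every \<open>y\<close> in dL(z, t - e y) in terms of b(z) and the norm of
  \<open>t\<close>, and testing the equation with f_e bounds f_e in terms of the risk of 0. Together
  they bound the monotone L2 norms and supply the integrable majorant for the limit. The inclusion
  is required at every point, whereas L2 convergence speaks only almost everywhere; hence a second,
  purely pointwise convergence argument with the function held fixed.\<close>

lemma norm_midpoint_diff_sq:
  fixes x y t :: "'a::real_inner"
  shows "(norm (midpoint x y - t))\<^sup>2 = ((norm (x - t))\<^sup>2 + (norm (y - t))\<^sup>2) / 2 - (norm (x - y))\<^sup>2 / 4"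
proof -
  have "midpoint x y - t = (1/2) *\<^sub>R ((x - t) + (y - t))"
    by (simp add: midpoint_def algebra_simps flip: scaleR_add_left)
  moreover have "x - y = (x - t) - (y - t)" by simp
  ultimately show ?thesis
    by (simp only: power2_norm_eq_inner) (simp add: inner_simps inner_commute field_simps)
qed

text \<open>If two values are within \<open>1 / real (Suc n)\<close> of the infimum, the midpoint
  value cannot fall below the infimum, so \<open>\<mu>\<close> times the squared distance is smaller
  than \<open>1 / real (Suc n)\<close>. Minimizing sequences are therefore Cauchy, and completeness
  suffices.\<close>

lemma midpoint_strongly_convex_minimizer:
  fixes \<Psi> :: "'a::{real_inner, banach} \<Rightarrow> real"
  assumes cont: "continuous_on UNIV \<Psi>" and mu: "0 < \<mu>"
    and mid: "\<And>x y. \<Psi> (midpoint x y) \<le> (\<Psi> x + \<Psi> y) / 2 - \<mu> * (norm (x - y))\<^sup>2"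
    and bd: "\<And>x. m \<le> \<Psi> x"
  shows "\<exists>p. \<forall>x. \<Psi> p \<le> \<Psi> x"
proof -
  define I where "I = Inf (range \<Psi>)"
  have bb: "bdd_below (range \<Psi>)" using bd by (auto intro!: bdd_belowI[of _ m])
  have I: "I \<le> \<Psi> x" for x unfolding I_def by (rule cInf_lower) (use bb in auto)
  have "\<exists>x. \<Psi> x < I + 1 / real (Suc n)" for n
    using cInf_lessD[of "range \<Psi>" "I + 1 / real (Suc n)"] unfolding I_def by auto
  then obtain s where s: "\<And>n. \<Psi> (s n) < I + 1 / real (Suc n)" by metis
  have dist: "\<mu> * (norm (s i - s j))\<^sup>2 < 1 / real (Suc n)" if "n \<le> i" "n \<le> j" for i j n
  proof -
    have "1 / real (Suc i) \<le> 1 / real (Suc n)" "1 / real (Suc j) \<le> 1 / real (Suc n)"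
      using that by (auto intro!: divide_left_mono)
    then show ?thesis
      using mid[of "s i" "s j"] I[of "midpoint (s i) (s j)"] s[of i] s[of j] by argo
  qed
  have "Cauchy s"
  proof (rule metric_CauchyI)
    fix e :: real assume e: "0 < e"
    then have "0 < \<mu> * e\<^sup>2" using mu by simp
    then obtain n where n: "1 / real (Suc n) < \<mu> * e\<^sup>2" using nat_approx_posE by metis
    have "dist (s i) (s j) < e" if "n \<le> i" "n \<le> j" for i j
    proof -
      have "\<mu> * (norm (s i - s j))\<^sup>2 < \<mu> * e\<^sup>2" using dist[OF that] n by linarith
      then have "(norm (s i - s j))\<^sup>2 < e\<^sup>2" using mu by simp
      then show ?thesis using e by (simp add: dist_norm power2_less_imp_less)
    qed
    then show "\<exists>M. \<forall>m\<ge>M. \<forall>n\<ge>M. dist (s m) (s n) < e" by blast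
  qed
  then obtain p where p: "s \<longlonglongrightarrow> p" using Cauchy_convergent convergent_def by blast
  have "(\<lambda>n. \<Psi> (s n)) \<longlonglongrightarrow> \<Psi> p"
    using cont p by (simp add: continuous_on_tendsto_compose)
  moreover have "(\<lambda>n. I + 1 / real (Suc n)) \<longlonglongrightarrow> I + 0"
    by (intro tendsto_intros LIMSEQ_Suc lim_1_over_n)
  ultimately have "\<Psi> p \<le> I + 0"
    by (rule LIMSEQ_le) (use s less_imp_le in blast)
  then show ?thesis using I by (metis add.right_neutral order_trans)
qed

lemma quadratic_nonneg_linear_coeff_zero:
  fixes a b :: real
  assumes "\<And>s. 0 \<le> s * a + s\<^sup>2 * b"
  shows "a = 0"
proof -
  have "0 \<le> b" using assms[of 1] assms[of "-1"] by simp
  then have N: "0 < b + 1" by simp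
  have "(- (a / (b + 1))) * a + (- (a / (b + 1)))\<^sup>2 * b = - (a / (b + 1))\<^sup>2"
    using N by (simp add: divide_simps) (simp add: power2_eq_square algebra_simps)
  then have "(a / (b + 1))\<^sup>2 \<le> 0" using assms[of "- (a / (b + 1))"] by simp
  then show ?thesis using N by simp
qed

text \<open>The representing vector is the minimizer of \<open>(norm f)\<^sup>2 - 2 * l f\<close>;
  vanishing of the first variation in direction \<open>f\<close> is the claimed identity.\<close>

lemma riesz_representation:
  fixes l :: "'a::{real_inner, banach} \<Rightarrow> real"
  assumes "bounded_linear l"
  obtains w where "\<And>f. l f = f \<bullet> w"
proof -
  interpret bounded_linear l by fact
  obtain K where K: "\<And>f. norm (l f) \<le> norm f * K" using bounded by blast
  let ?P = "\<lambda>f. (norm f)\<^sup>2 - 2 * l f"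
  have "\<exists>p. \<forall>x. ?P p \<le> ?P x"
  proof (rule midpoint_strongly_convex_minimizer)
    show "continuous_on UNIV ?P" by (intro continuous_intros linear_continuous_on assms)
    show "0 < (1/4::real)" by simp
    show "?P (midpoint x y) \<le> (?P x + ?P y) / 2 - 1/4 * (norm (x - y))\<^sup>2" for x y
      using norm_midpoint_diff_sq[of x y 0] by (simp add: midpoint_def scaleR add field_simps)
    show "- K\<^sup>2 \<le> ?P x" for x
    proof -
      have "0 \<le> (norm x - K)\<^sup>2" by simp
      then show ?thesis using K[of x] by (simp add: power2_eq_square algebra_simps abs_le_iff)
    qed
  qed
  then obtain p where p: "\<And>x. ?P p \<le> ?P x" by blast
  have "l f = f \<bullet> p" for f
  proof -
    have *: "0 \<le> s * (2 * (f \<bullet> p) - 2 * l f) + s\<^sup>2 * (norm f)\<^sup>2" for s :: real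
      using p[of "p + s *\<^sub>R f"] unfolding power2_norm_eq_inner
      by (simp add: inner_simps add scaleR inner_commute algebra_simps power2_eq_square)
    then have "2 * (f \<bullet> p) - 2 * l f = 0" by (rule quadratic_nonneg_linear_coeff_zero)
    then show ?thesis by simp
  qed
  then show ?thesis using that by blast
qed

lemma adjoint_characterization:
  fixes S :: "'a::{real_inner, banach} \<Rightarrow> 'b::real_inner"
  assumes "bounded_linear S"
  shows "S f \<bullet> y = f \<bullet> adjoint S y"
proof -
  have "\<exists>w. \<forall>f. S f \<bullet> y = f \<bullet> w" for y
    using riesz_representation[OF bounded_linear_compose[OF bounded_linear_inner_left assms, of y]]
    by metis
  then have "\<exists>S'. \<forall>f y. S f \<bullet> y = f \<bullet> S' y" by metis
  then show ?thesis unfolding adjoint_def by (rule someI2_ex) blast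
qed

text \<open>The step \<open>f - \<tau> *\<^sub>R A f\<close> is a contraction for suitable
  \<open>\<tau>\<close>. The squared factor
  \<open>1 - 2 * \<tau> * \<mu> + \<tau>\<^sup>2 * \<Lambda>\<^sup>2\<close> is smallest at
  \<open>\<tau> = \<mu> / \<Lambda>\<^sup>2\<close>, where it equals \<open>q\<close>.\<close>

lemma strongly_monotone_lipschitz_zero:
  fixes A :: "'a::{real_inner, banach} \<Rightarrow> 'a"
  assumes mu: "0 < \<mu>"
    and mono: "\<And>f g. \<mu> * (norm (f - g))\<^sup>2 \<le> (A f - A g) \<bullet> (f - g)"
    and lip: "\<And>f g. norm (A f - A g) \<le> \<Lambda> * norm (f - g)"
  obtains f where "A f = 0"
proof (cases "\<exists>f g :: 'a. f \<noteq> g")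
  case False
  then show ?thesis using that[of 0] by metis
next
  case True
  \<comment> \<open>Two distinct points force \<open>\<mu> \<le> \<Lambda>\<close>, which makes
    \<open>\<Lambda>\<close> positive and \<open>q\<close> nonnegative. In a one-point space
    \<open>\<Lambda>\<close> could be anything.\<close>
  then obtain f0 g0 :: 'a where "f0 \<noteq> g0" by blast
  have "(A f0 - A g0) \<bullet> (f0 - g0) \<le> norm (A f0 - A g0) * norm (f0 - g0)"
    by (rule norm_cauchy_schwarz)
  also have "\<dots> \<le> \<Lambda> * (norm (f0 - g0))\<^sup>2"
    using lip[of f0 g0] by (simp add: mult_right_mono power2_eq_square flip: mult.assoc)
  finally have "\<mu> * (norm (f0 - g0))\<^sup>2 \<le> \<Lambda> * (norm (f0 - g0))\<^sup>2"
    using mono[of f0 g0] by linarith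
  then have mL: "\<mu> \<le> \<Lambda>" using \<open>f0 \<noteq> g0\<close> by simp
  define \<tau> where "\<tau> = \<mu> / \<Lambda>\<^sup>2"
  define q where "q = 1 - \<mu>\<^sup>2 / \<Lambda>\<^sup>2"
  have L: "\<Lambda> > 0" using mu mL by simp
  have "\<mu>\<^sup>2 \<le> \<Lambda>\<^sup>2" using mu mL by (simp add: power_mono)
  then have q: "0 \<le> q" "q < 1" using mu L by (auto simp: q_def)
  have "norm ((f - \<tau> *\<^sub>R A f) - (g - \<tau> *\<^sub>R A g)) \<le> sqrt q * norm (f - g)" for f g
  proof -
    have "(norm ((f - \<tau> *\<^sub>R A f) - (g - \<tau> *\<^sub>R A g)))\<^sup>2 = (norm ((f - g) - \<tau> *\<^sub>R (A f - A g)))\<^sup>2"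
      by (simp add: algebra_simps)
    also have "\<dots> = (norm (f - g))\<^sup>2 - 2 * \<tau> * ((A f - A g) \<bullet> (f - g)) + \<tau>\<^sup>2 * (norm (A f - A g))\<^sup>2"
      by (simp only: power2_norm_eq_inner)
         (simp add: inner_diff_right inner_diff_left inner_commute algebra_simps power2_eq_square)
    also have "\<dots> \<le> (norm (f - g))\<^sup>2 - 2 * \<tau> * (\<mu> * (norm (f - g))\<^sup>2) + \<tau>\<^sup>2 * (\<Lambda> * norm (f - g))\<^sup>2"
      using mono[of f g] lip[of f g] mu
      by (intro add_mono diff_mono mult_left_mono power_mono) (auto simp: \<tau>_def)
    also have "\<dots> = q * (norm (f - g))\<^sup>2"
      using L by (simp add: q_def \<tau>_def field_simps power2_eq_square)
    also have "\<dots> = (sqrt q * norm (f - g))\<^sup>2" using q by (simp add: power_mult_distrib)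
    finally show ?thesis by (rule power2_le_imp_le) (use q in auto)
  qed
  then have "\<exists>!f. f - \<tau> *\<^sub>R A f = f"
    by (intro banach_fix_type[of "sqrt q"]) (use q in \<open>auto simp: dist_norm\<close>)
  then obtain f where "f - \<tau> *\<^sub>R A f = f" by blast
  then have "\<tau> *\<^sub>R A f = 0" by (simp add: algebra_simps)
  then have "A f = 0" using mu L by (simp add: \<tau>_def)
  then show ?thesis by (rule that)
qed

section \<open>Subgradients and the Yosida approximation\<close>

lemma subdifferential_monotone:
  assumes "v \<in> subdifferential F s" "w \<in> subdifferential F t"
  shows "0 \<le> (v - w) \<bullet> (s - t)"
proof -
  have "F t \<ge> F s + v \<bullet> (t - s)" "F s \<ge> F t + w \<bullet> (s - t)"
    using assms by (auto simp: subdifferential_def)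
  then show ?thesis by (simp add: inner_diff_left inner_diff_right)
qed

text \<open>Comparing with the point \<open>t + y / (4 c)\<close> balances the quadratic terms.\<close>

lemma subdifferential_resolvent_bound:
  fixes F :: "'a::real_inner \<Rightarrow> real"
  assumes sub: "y \<in> subdifferential F (t - e *\<^sub>R y)" and "0 \<le> e"
    and pos: "\<And>s. 0 \<le> F s" and growth: "\<And>s. F s \<le> b + c * (norm s)\<^sup>2" and c: "0 < c"
  shows "(norm y)\<^sup>2 \<le> 8 * c * (b + 2 * c * (norm t)\<^sup>2)"
proof -
  define d where "d = 1 / (4 * c)"
  have d: "0 < d" "d * c = 1/4" using c by (auto simp: d_def)
  have "F (t + d *\<^sub>R y) \<ge> F (t - e *\<^sub>R y) + y \<bullet> (t + d *\<^sub>R y - (t - e *\<^sub>R y))"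
    using sub by (simp only: subdifferential_def mem_Collect_eq)
  moreover have "y \<bullet> (t + d *\<^sub>R y - (t - e *\<^sub>R y)) = d * (norm y)\<^sup>2 + e * (norm y)\<^sup>2"
    by (simp add: inner_simps power2_norm_eq_inner)
  \<comment> \<open>This term is simply dropped, so the bound does not depend on \<open>e\<close>;
    the case \<open>e = 0\<close> covers genuine subgradients at \<open>t\<close>.\<close>
  moreover have "0 \<le> e * (norm y)\<^sup>2" using \<open>0 \<le> e\<close> by simp
  moreover have "F (t + d *\<^sub>R y) \<le> b + c * (norm (t + d *\<^sub>R y))\<^sup>2" by (rule growth)
  moreover have "(norm (t + d *\<^sub>R y))\<^sup>2 + (norm (t - d *\<^sub>R y))\<^sup>2 = 2 * (norm t)\<^sup>2 + 2 * (d * norm y)\<^sup>2"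
    unfolding power_mult_distrib power2_norm_eq_inner by (simp add: inner_simps inner_commute algebra_simps power2_eq_square)
  then have "c * (norm (t + d *\<^sub>R y))\<^sup>2 \<le> c * (2 * (norm t)\<^sup>2 + 2 * (d * norm y)\<^sup>2)"
    using c zero_le_power2[of "norm (t - d *\<^sub>R y)"] by (intro mult_left_mono) linarith+
  moreover have "c * (2 * (norm t)\<^sup>2 + 2 * (d * norm y)\<^sup>2) = 2 * c * (norm t)\<^sup>2 + d * (norm y)\<^sup>2 / 2"
    using d by (simp add: power2_eq_square algebra_simps)
  ultimately have "d * (norm y)\<^sup>2 / 2 \<le> b + 2 * c * (norm t)\<^sup>2"
    using pos[of "t - e *\<^sub>R y"] by linarith
  then show ?thesis using c by (simp add: d_def field_simps)
qed

text \<open>The implicit equation encodes the proximal point as \<open>t - e *\<^sub>R y\<close>.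
  For positive \<open>e\<close> the choice is determined: for two solutions \<open>y\<close> and
  \<open>y'\<close>, monotonicity makes \<open>- e * (norm (y - y'))\<^sup>2\<close>
  nonnegative.\<close>

definition yosida :: "real \<Rightarrow> ('a::real_inner \<Rightarrow> real) \<Rightarrow> 'a \<Rightarrow> 'a"
  where "yosida e F t = (SOME y. y \<in> subdifferential F (t - e *\<^sub>R y))"

text \<open>The proximal point \<open>p\<close> minimizes \<open>F\<close> plus the quadratic
  penalty \<open>(norm (s - t))\<^sup>2 / (2 * e)\<close>, and the optimality condition says that
  \<open>(t - p) / e\<close> is a subgradient at \<open>p\<close>. The modulus
  \<open>1 / (8 * e)\<close> is the quarter from the midpoint identity times the penalty
  weight.\<close>

lemma yosida_in_subdifferential:
  fixes F :: "'a::{real_inner, banach} \<Rightarrow> real"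
  assumes conv: "convex_on UNIV F" and cont: "continuous_on UNIV F"
    and pos: "\<And>s. 0 \<le> F s" and e: "0 < e"
  shows "yosida e F t \<in> subdifferential F (t - e *\<^sub>R yosida e F t)"
proof -
  let ?P = "\<lambda>s. F s + (norm (s - t))\<^sup>2 / (2 * e)"
  have "\<exists>p. \<forall>x. ?P p \<le> ?P x"
  proof (rule midpoint_strongly_convex_minimizer)
    show "continuous_on UNIV ?P" by (intro continuous_intros cont) (use e in auto)
    show "0 < 1 / (8 * e)" using e by simp
    show "0 \<le> ?P x" for x using pos[of x] e by simp
    show "?P (midpoint x y) \<le> (?P x + ?P y) / 2 - 1 / (8 * e) * (norm (x - y))\<^sup>2" for x y
    proof -
      have "F (midpoint x y) \<le> (F x + F y) / 2"
        using convex_onD[OF conv, of "1/2" x y] by (simp add: midpoint_def scaleR_add_right field_simps)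
      moreover have "(norm (midpoint x y - t))\<^sup>2 / (2 * e) =
          ((norm (x - t))\<^sup>2 / (2 * e) + (norm (y - t))\<^sup>2 / (2 * e)) / 2 - 1 / (8 * e) * (norm (x - y))\<^sup>2"
        unfolding norm_midpoint_diff_sq by (simp add: diff_divide_distrib add_divide_distrib)
      ultimately show ?thesis by argo
    qed
  qed
  then obtain p where p: "\<And>x. ?P p \<le> ?P x" by blast
  define y where "y = (1 / e) *\<^sub>R (t - p)"
  have py: "p = t - e *\<^sub>R y" using e by (simp add: y_def)
  have "F p + y \<bullet> (s - p) \<le> F s" for s
  proof -
    \<comment> \<open>Comparing \<open>p\<close> with a point of the segment towards
      \<open>s\<close> and dividing by \<open>u\<close> leaves a remainder linear in
      \<open>u\<close>, which disappears as \<open>u\<close> tends to 0.\<close>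
    have *: "0 \<le> F s - F p - y \<bullet> (s - p) + u * ((norm (s - p))\<^sup>2 / (2 * e))" if u: "0 < u" "u < 1" for u :: real
    proof -
      have "?P p \<le> ?P ((1 - u) *\<^sub>R p + u *\<^sub>R s)" by (rule p)
      also have "\<dots> \<le> (1 - u) * F p + u * F s + (norm ((1 - u) *\<^sub>R p + u *\<^sub>R s - t))\<^sup>2 / (2 * e)"
        using convex_onD[OF conv, of u p s] u by auto
      also have "(1 - u) *\<^sub>R p + u *\<^sub>R s - t = u *\<^sub>R (s - p) - e *\<^sub>R y"
        by (simp add: py algebra_simps)
      also have "(norm (u *\<^sub>R (s - p) - e *\<^sub>R y))\<^sup>2 = u\<^sup>2 * (norm (s - p))\<^sup>2 - 2 * u * e * (y \<bullet> (s - p)) + (norm (p - t))\<^sup>2"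
        unfolding py
        by (simp only: power2_norm_eq_inner)
           (simp add: inner_diff_right inner_diff_left inner_commute algebra_simps power2_eq_square)
      finally have "0 \<le> u * (F s - F p - y \<bullet> (s - p) + u * ((norm (s - p))\<^sup>2 / (2 * e)))"
        using e by (simp add: diff_divide_distrib add_divide_distrib power2_eq_square algebra_simps)
      then show ?thesis using u by (simp add: zero_le_mult_iff)
    qed
    have "((\<lambda>u. F s - F p - y \<bullet> (s - p) + u * ((norm (s - p))\<^sup>2 / (2 * e))) \<longlongrightarrow>
        F s - F p - y \<bullet> (s - p) + 0 * ((norm (s - p))\<^sup>2 / (2 * e))) (at_right 0)"
      by (intro tendsto_intros)
    moreover have "\<forall>\<^sub>F u in at_right 0. 0 \<le> F s - F p - y \<bullet> (s - p) + u * ((norm (s - p))\<^sup>2 / (2 * e))"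
      unfolding eventually_at_right_field using * by (intro exI[of _ 1]) auto
    ultimately have "0 \<le> F s - F p - y \<bullet> (s - p) + 0 * ((norm (s - p))\<^sup>2 / (2 * e))"
      by (intro tendsto_lowerbound) auto
    then show ?thesis by simp
  qed
  then have "y \<in> subdifferential F (t - e *\<^sub>R y)" by (simp add: subdifferential_def py)
  then show ?thesis unfolding yosida_def by (rule someI[of "\<lambda>y. y \<in> subdifferential F (t - e *\<^sub>R y)"])
qed

text \<open>Two parameters are allowed so that the same inequality yields the Lipschitz bound
  (\<open>d = e\<close>) and the comparison of different regularizations.\<close>

lemma resolvent_monotone:
  assumes "v \<in> subdifferential F (s - d *\<^sub>R v)" "w \<in> subdifferential F (t - e *\<^sub>R w)"
  shows "(v - w) \<bullet> (d *\<^sub>R v - e *\<^sub>R w) \<le> (v - w) \<bullet> (s - t)"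
  using subdifferential_monotone[OF assms] by (simp add: inner_diff_right)

text \<open>\<open>d *\<^sub>R v - e *\<^sub>R w\<close> is \<open>(d + e) / 2\<close> times
  \<open>v - w\<close> plus \<open>(d - e) / 2\<close> times \<open>v + w\<close>, and
  \<open>(v - w) \<bullet> (v + w)\<close> is a difference of squared norms.\<close>

lemma two_parameter_identity:
  fixes v w :: "'a::real_inner"
  shows "(d + e) * (norm (v - w))\<^sup>2 = (d - e) * ((norm w)\<^sup>2 - (norm v)\<^sup>2) + 2 * ((v - w) \<bullet> (d *\<^sub>R v - e *\<^sub>R w))"
  unfolding power2_norm_eq_inner
  by (simp add: inner_diff_right inner_diff_left inner_commute algebra_simps)

lemma subdifferential_limit:
  fixes F :: "'a::real_inner \<Rightarrow> real"
  assumes cont: "continuous_on UNIV F"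
    and sub: "\<And>n::nat. v n \<in> subdifferential F (p n)" and v: "v \<longlonglongrightarrow> w" and p: "p \<longlonglongrightarrow> t"
  shows "w \<in> subdifferential F t"
  unfolding subdifferential_def
proof safe
  fix s
  have "(\<lambda>n. F (p n)) \<longlonglongrightarrow> F t" using cont p by (simp add: continuous_on_tendsto_compose)
  then have "(\<lambda>n. F (p n) + v n \<bullet> (s - p n)) \<longlonglongrightarrow> F t + w \<bullet> (s - t)"
    by (intro tendsto_intros v p)
  then show "F t + w \<bullet> (s - t) \<le> F s"
    by (rule LIMSEQ_le_const2) (use sub in \<open>auto simp: subdifferential_def\<close>)
qed

text \<open>In infinite dimension convexity alone does not give continuity; nonnegativity and growth
  supply boundedness on every ball, which does.\<close>

lemma convex_continuous_quadratic_growth: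
  fixes F :: "'a::real_inner \<Rightarrow> real"
  assumes conv: "convex_on UNIV F" and pos: "\<And>s. 0 \<le> F s" and growth: "\<And>s. F s \<le> b + c * (norm s)\<^sup>2" and c: "0 < c"
  shows "continuous_on UNIV F"
proof -
  have "continuous_on (ball 0 r) F" for r
  proof (rule convex_on_bounded_continuous)
    show "convex_on (ball 0 r) F" using conv by (rule convex_on_subset) auto
    show "\<forall>x\<in>ball 0 r. \<bar>F x\<bar> \<le> b + c * r\<^sup>2"
    proof
      fix x :: 'a assume "x \<in> ball 0 r"
      then have "(norm x)\<^sup>2 \<le> r\<^sup>2" by (intro power_mono) auto
      then have "c * (norm x)\<^sup>2 \<le> c * r\<^sup>2" using c by simp
      then show "\<bar>F x\<bar> \<le> b + c * r\<^sup>2" using pos[of x] growth[of x] by linarith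
    qed
  qed auto
  moreover have "x \<in> ball 0 (norm x + 1)" for x :: 'a by simp
  ultimately show ?thesis
    by (meson continuous_at_imp_continuous_on continuous_on_eq_continuous_at open_ball)
qed

section \<open>Measurability of minimizers\<close>

lemma dense_sequence_exists:
  obtains d :: "nat \<Rightarrow> 'a::{metric_space, second_countable_topology}"
  where "\<And>x e. 0 < e \<Longrightarrow> \<exists>n. dist (d n) x < e"
proof -
  obtain D :: "'a set" where D: "countable D" "\<And>X. open X \<Longrightarrow> X \<noteq> {} \<Longrightarrow> \<exists>d\<in>D. d \<in> X"
    by (rule countable_dense_setE) blast
  have "D \<noteq> {}" using D(2)[of UNIV] by auto
  then have r: "range (from_nat_into D) = D" using D(1) by (rule range_from_nat_into)
  have "\<exists>n. dist (from_nat_into D n) x < e" if e: "0 < e" for x e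
  proof -
    obtain y where "y \<in> D" "y \<in> ball x e" using D(2)[of "ball x e"] e by auto
    then obtain n where "y = from_nat_into D n" using r by blast
    then show ?thesis using \<open>y \<in> ball x e\<close> by (auto simp: dist_commute)
  qed
  then show ?thesis by (rule that)
qed

text \<open>An approximate minimizer can be chosen measurably along a dense sequence; quadratic growth
  makes these choices converge to the minimizer.\<close>

lemma borel_measurable_minimizer:
  fixes \<Psi> :: "'z \<Rightarrow> 'a::{metric_space, second_countable_topology} \<Rightarrow> real"
  assumes meas: "\<And>s. (\<lambda>z. \<Psi> z s) \<in> borel_measurable M"
    and cont: "\<And>z. z \<in> space M \<Longrightarrow> continuous_on UNIV (\<Psi> z)"
    and grow: "\<And>z s. z \<in> space M \<Longrightarrow> \<Psi> z (p z) + \<mu> * (dist s (p z))\<^sup>2 \<le> \<Psi> z s"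
    and mu: "0 < \<mu>"
  shows "p \<in> borel_measurable M"
proof -
  obtain d :: "nat \<Rightarrow> 'a" where d: "\<And>x e. 0 < e \<Longrightarrow> \<exists>n. dist (d n) x < e"
    by (rule dense_sequence_exists) blast
  have min: "\<Psi> z (p z) \<le> \<Psi> z s" if "z \<in> space M" for z s
    using grow[OF that, of s] mu zero_le_power2[of "dist s (p z)"]
    by (smt (verit) mult_nonneg_nonneg)
  have near: "\<exists>n. \<Psi> z (d n) < \<Psi> z (p z) + e" if z: "z \<in> space M" and e: "0 < e" for z e
  proof -
    have "continuous (at (p z)) (\<Psi> z)"
      using cont[OF z] by (simp add: continuous_on_eq_continuous_at)
    then obtain r where "0 < r" "\<And>x. dist x (p z) < r \<Longrightarrow> dist (\<Psi> z x) (\<Psi> z (p z)) < e"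
      using e unfolding continuous_at_eps_delta by blast
    moreover obtain n where "dist (d n) (p z) < r" using d \<open>0 < r\<close> by blast
    ultimately have "dist (\<Psi> z (d n)) (\<Psi> z (p z)) < e" by blast
    then show ?thesis by (intro exI[of _ n]) (simp add: dist_real_def)
  qed
  \<comment> \<open>The minimal value \<open>\<Psi> z (p z)\<close> is not visibly measurable while
    \<open>p\<close> is still under study. The countable infimum is measurable and has the same
    value on \<open>space M\<close>.\<close>
  define m where "m z = (INF n. \<Psi> z (d n))" for z
  have bdd: "bdd_below (range (\<lambda>n. \<Psi> z (d n)))" if "z \<in> space M" for z
    using min[OF that] by (auto intro!: bdd_belowI[of _ "\<Psi> z (p z)"])
  have m: "m z = \<Psi> z (p z)" if z: "z \<in> space M" for z
  proof (rule antisym)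
    show "\<Psi> z (p z) \<le> m z" unfolding m_def by (rule cINF_greatest) (use min[OF z] in auto)
    show "m z \<le> \<Psi> z (p z)"
    proof (rule field_le_epsilon)
      fix e :: real assume "0 < e"
      then obtain n where "\<Psi> z (d n) < \<Psi> z (p z) + e" using near z by blast
      moreover have "m z \<le> \<Psi> z (d n)" unfolding m_def by (rule cINF_lower[OF bdd[OF z]]) simp
      ultimately show "m z \<le> \<Psi> z (p z) + e" by linarith
    qed
  qed
  note meas[measurable]
  have [measurable]: "m \<in> borel_measurable M"
    unfolding m_def by (rule borel_measurable_cINF_real) auto
  define N where "N k z = (LEAST n. \<Psi> z (d n) < m z + 1 / real (Suc k))" for k z
  have [measurable]: "N k \<in> measurable M (count_space UNIV)" for k
    unfolding N_def by measurable
  have Nk: "\<Psi> z (d (N k z)) < \<Psi> z (p z) + 1 / real (Suc k)" if z: "z \<in> space M" for k z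
    unfolding N_def m[OF z] by (rule LeastI_ex) (use near[OF z] in simp)
  show ?thesis
  proof (rule borel_measurable_LIMSEQ_metric)
    show "(\<lambda>z. d (N k z)) \<in> borel_measurable M" for k by measurable
    fix z assume z: "z \<in> space M"
    show "(\<lambda>k. d (N k z)) \<longlonglongrightarrow> p z"
    proof (rule metric_LIMSEQ_I)
      fix e :: real assume e: "0 < e"
      then have "0 < \<mu> * e\<^sup>2" using mu by simp
      then obtain k0 where k0: "1 / real (Suc k0) < \<mu> * e\<^sup>2" using nat_approx_posE by metis
      have "dist (d (N k z)) (p z) < e" if "k0 \<le> k" for k
      proof -
        have "1 / real (Suc k) \<le> 1 / real (Suc k0)" using that by (auto intro!: divide_left_mono)
        then have "\<mu> * (dist (d (N k z)) (p z))\<^sup>2 < \<mu> * e\<^sup>2"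
          using Nk[OF z, of k] grow[OF z, of "d (N k z)"] k0 by linarith
        then show ?thesis using mu e by (simp add: power2_less_imp_less)
      qed
      then show "\<exists>no. \<forall>k\<ge>no. dist (d (N k z)) (p z) < e" by blast
    qed
  qed
qed

text \<open>Pettis' theorem as a case of measurable minimizers: \<open>u z\<close> minimizes a
  function of \<open>s\<close> into which \<open>z\<close> enters only through
  \<open>s \<bullet> u z\<close>.\<close>

lemma borel_measurable_weakly:
  fixes u :: "'z \<Rightarrow> 'a::{real_inner, second_countable_topology}"
  assumes "\<And>f. (\<lambda>z. f \<bullet> u z) \<in> borel_measurable M"
  shows "u \<in> borel_measurable M"
proof (rule borel_measurable_minimizer[where \<mu> = 1 and \<Psi> = "\<lambda>z s. (norm s)\<^sup>2 - 2 * (s \<bullet> u z)"])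
  show "(\<lambda>z. (norm s)\<^sup>2 - 2 * (s \<bullet> u z)) \<in> borel_measurable M" for s
    using assms[of s] by measurable
  show "continuous_on UNIV (\<lambda>s. (norm s)\<^sup>2 - 2 * (s \<bullet> u z))" for z
    by (intro continuous_intros)
  show "(norm (u z))\<^sup>2 - 2 * (u z \<bullet> u z) + 1 * (dist s (u z))\<^sup>2 \<le> (norm s)\<^sup>2 - 2 * (s \<bullet> u z)" for z s
    unfolding dist_norm power2_norm_eq_inner by (simp add: inner_diff inner_commute)
qed simp

text \<open>Expanding the penalty around the proximal point produces a cross term that cancels the
  subgradient term, so the objective grows quadratically with factor \<open>1 / (2 * e)\<close>, as
  \<open>borel_measurable_minimizer\<close> asks.\<close>

lemma borel_measurable_yosida:
  fixes F :: "'z \<Rightarrow> 'a::{real_inner, banach, second_countable_topology} \<Rightarrow> real"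
  assumes conv: "\<And>z. z \<in> space M \<Longrightarrow> convex_on UNIV (F z)"
    and cont: "\<And>z. z \<in> space M \<Longrightarrow> continuous_on UNIV (F z)"
    and pos: "\<And>z s. z \<in> space M \<Longrightarrow> 0 \<le> F z s"
    and meas: "\<And>s. (\<lambda>z. F z s) \<in> borel_measurable M"
    and t[measurable]: "t \<in> borel_measurable M" and e: "0 < e"
  shows "(\<lambda>z. yosida e (F z) (t z)) \<in> borel_measurable M"
proof -
  let ?y = "\<lambda>z. yosida e (F z) (t z)"
  have "(\<lambda>z. t z - e *\<^sub>R ?y z) \<in> borel_measurable M"
  proof (rule borel_measurable_minimizer[where \<mu> = "1 / (2 * e)" and \<Psi> = "\<lambda>z s. F z s + (norm (s - t z))\<^sup>2 / (2 * e)"])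
    show "(\<lambda>z. F z s + (norm (s - t z))\<^sup>2 / (2 * e)) \<in> borel_measurable M" for s
      using meas[of s] by measurable
    fix z assume z: "z \<in> space M"
    show "continuous_on UNIV (\<lambda>s. F z s + (norm (s - t z))\<^sup>2 / (2 * e))"
      by (intro continuous_intros cont[OF z]) (use e in auto)
    fix s
    let ?p = "t z - e *\<^sub>R ?y z"
    have "F z ?p + ?y z \<bullet> (s - ?p) \<le> F z s"
      using yosida_in_subdifferential[OF conv cont pos e, OF z z z, of "t z"]
      unfolding subdifferential_def mem_Collect_eq by blast
    moreover have "(norm (s - t z))\<^sup>2 = (norm (s - ?p))\<^sup>2 - 2 * e * (?y z \<bullet> (s - ?p)) + (norm (?p - t z))\<^sup>2"
      unfolding power2_norm_eq_inner
      by (simp add: inner_diff_right inner_diff_left inner_add_left inner_add_right inner_commute algebra_simps)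
    then have "(norm (s - t z))\<^sup>2 / (2 * e) =
        (norm (s - ?p))\<^sup>2 / (2 * e) - ?y z \<bullet> (s - ?p) + (norm (?p - t z))\<^sup>2 / (2 * e)"
      using e by (simp add: add_divide_distrib diff_divide_distrib)
    ultimately show "F z ?p + (norm (?p - t z))\<^sup>2 / (2 * e) + 1 / (2 * e) * (dist s ?p)\<^sup>2
        \<le> F z s + (norm (s - t z))\<^sup>2 / (2 * e)"
      unfolding dist_norm by simp
  qed (use e in simp)
  then have "(\<lambda>z. (1 / e) *\<^sub>R (t z - (t z - e *\<^sub>R ?y z))) \<in> borel_measurable M"
    by measurable
  then show ?thesis using e by simp
qed

section \<open>Convergence of Yosida approximations\<close>

lemma two_parameter_estimate:
  fixes v w :: "'a::real_inner"
  assumes "0 < e" "e < d" "(v - w) \<bullet> (d *\<^sub>R v - e *\<^sub>R w) \<le> 0"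
  shows "(norm (v - w))\<^sup>2 \<le> (norm w)\<^sup>2 - (norm v)\<^sup>2"
proof -
  have "(d + e) * (norm (v - w))\<^sup>2 \<le> (d - e) * ((norm w)\<^sup>2 - (norm v)\<^sup>2)"
    using two_parameter_identity[of d e v w] assms by linarith
  moreover have "(d - e) * (norm (v - w))\<^sup>2 \<le> (d + e) * (norm (v - w))\<^sup>2"
    using assms by (intro mult_right_mono) auto
  ultimately have "(d - e) * (norm (v - w))\<^sup>2 \<le> (d - e) * ((norm w)\<^sup>2 - (norm v)\<^sup>2)" by linarith
  then show ?thesis using assms by simp
qed

text \<open>\<open>D\<close> is abstract because it stands for squared distances both at a fixed
  point and in L2. Nonnegative increments make \<open>a\<close> increasing, hence convergent, and
  its Cauchy property passes to \<open>D\<close>.\<close>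

lemma increment_bound_Cauchy:
  fixes a :: "nat \<Rightarrow> real" and D :: "nat \<Rightarrow> nat \<Rightarrow> real"
  assumes sym: "\<And>n m. D n m = D m n" and diag: "\<And>n. D n n = 0" and pos: "\<And>n m. 0 \<le> D n m"
    and inc: "\<And>n m. n < m \<Longrightarrow> D n m \<le> a m - a n" and bd: "\<And>n. a n \<le> A" and e: "0 < e"
  shows "\<exists>N. \<forall>i\<ge>N. \<forall>j\<ge>N. D i j < e"
proof -
  have "incseq a" using inc pos by (intro incseq_SucI) (smt (verit) lessI)
  then obtain l where "a \<longlonglongrightarrow> l" using incseq_convergent[of a A] bd by blast
  then have "Cauchy a" by (rule LIMSEQ_imp_Cauchy)
  then obtain N where N: "\<And>i j. N \<le> i \<Longrightarrow> N \<le> j \<Longrightarrow> dist (a i) (a j) < e"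
    using e unfolding Cauchy_def by blast
  have "D i j < e" if "N \<le> i" "N \<le> j" for i j
    using N[OF that] inc[of i j] inc[of j i] sym[of i j] diag[of i] e
    by (cases i j rule: linorder_cases) (auto simp: dist_real_def)
  then show ?thesis by blast
qed

text \<open>With the same \<open>t\<close> for both parameters the right-hand side of
  \<open>resolvent_monotone\<close> is 0. This gives convergence at every single point, including
  those about which an L2 argument says nothing.\<close>

lemma yosida_Cauchy:
  fixes F :: "'a::{real_inner, banach} \<Rightarrow> real"
  assumes conv: "convex_on UNIV F" and pos: "\<And>s. 0 \<le> F s"
    and growth: "\<And>s. F s \<le> b + c * (norm s)\<^sup>2" and c: "0 < c"
  shows "Cauchy (\<lambda>n. yosida (1 / real (Suc n)) F t)"
proof -
  let ?y = "\<lambda>n. yosida (1 / real (Suc n)) F t"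
  have cont: "continuous_on UNIV F" by (rule convex_continuous_quadratic_growth[OF conv pos growth c])
  have sub: "?y n \<in> subdifferential F (t - (1 / real (Suc n)) *\<^sub>R ?y n)" for n
    by (rule yosida_in_subdifferential[OF conv cont pos]) simp
  show ?thesis
  proof (rule metric_CauchyI)
    fix e :: real assume e: "0 < e"
    have "\<exists>N. \<forall>i\<ge>N. \<forall>j\<ge>N. (norm (?y i - ?y j))\<^sup>2 < e\<^sup>2"
    proof (rule increment_bound_Cauchy)
      show "(norm (?y n - ?y m))\<^sup>2 \<le> (norm (?y m))\<^sup>2 - (norm (?y n))\<^sup>2" if "n < m" for n m
        using resolvent_monotone[OF sub[of n] sub[of m]] that
        by (intro two_parameter_estimate[of "1 / real (Suc m)" "1 / real (Suc n)"])
           (auto simp: frac_less2)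
      show "(norm (?y n))\<^sup>2 \<le> 8 * c * (b + 2 * c * (norm t)\<^sup>2)" for n
        by (rule subdifferential_resolvent_bound[OF sub _ pos growth c]) simp
    qed (use e in \<open>auto simp: norm_minus_commute\<close>)
    then show "\<exists>N. \<forall>i\<ge>N. \<forall>j\<ge>N. dist (?y i) (?y j) < e"
      using e unfolding dist_norm by (meson less_imp_le power2_less_imp_less)
  qed
qed

lemma subdifferential_resolvent_limit:
  fixes F :: "'a::real_inner \<Rightarrow> real"
  assumes cont: "continuous_on UNIV F"
    and sub: "\<And>n::nat. v n \<in> subdifferential F (p n - e n *\<^sub>R v n)" and v: "v \<longlonglongrightarrow> w"
    and p: "p \<longlonglongrightarrow> t" and e: "e \<longlonglongrightarrow> 0"
  shows "w \<in> subdifferential F t"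
proof (rule subdifferential_limit[OF cont sub v])
  have "(\<lambda>n. p n - e n *\<^sub>R v n) \<longlonglongrightarrow> t - 0 *\<^sub>R w" by (intro tendsto_intros p e v)
  then show "(\<lambda>n. p n - e n *\<^sub>R v n) \<longlonglongrightarrow> t" by simp
qed

section \<open>Subgradient selections in a Hilbert space of functions\<close>

lemma norm_le_of_sq:
  fixes y :: "'a::real_normed_vector"
  assumes "(norm y)\<^sup>2 \<le> w"
  shows "norm y \<le> 1 + w"
proof -
  have "2 * norm y \<le> (norm y)\<^sup>2 + 1"
    using zero_le_power2[of "norm y - 1"] by (simp add: power2_diff)
  then show ?thesis using assms zero_le_power2[of "norm y"] by linarith
qed

text \<open>Here \<open>z\<close> plays the role of \<open>(x, y)\<close>, \<open>F z\<close> of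
  \<open>L x y\<close>, \<open>S z\<close> of evaluation at \<open>x\<close> and
  \<open>\<Phi> z\<close> of its adjoint. Measurability of \<open>F\<close> is asked in composed
  form, the form in which the integrands use it.\<close>

locale convex_integral_problem = prob_space M for M :: "'z measure" +
  fixes F :: "'z \<Rightarrow> 'g::{real_inner, banach, second_countable_topology} \<Rightarrow> real"
    and S :: "'z \<Rightarrow> 'h::{real_inner, banach, second_countable_topology} \<Rightarrow> 'g"
    and \<Phi> :: "'z \<Rightarrow> 'g \<Rightarrow> 'h"
    and b :: "'z \<Rightarrow> real" and c \<kappa> lam :: real
  assumes F_measurable: "\<And>t. t \<in> borel_measurable M \<Longrightarrow> (\<lambda>z. F z (t z)) \<in> borel_measurable M"
    and F_convex: "\<And>z. z \<in> space M \<Longrightarrow> convex_on UNIV (F z)"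
    and F_nonneg: "\<And>z s. z \<in> space M \<Longrightarrow> 0 \<le> F z s"
    and F_growth: "\<And>z s. z \<in> space M \<Longrightarrow> F z s \<le> b z + c * (norm s)\<^sup>2"
    and b_integrable: "integrable M b" and c_pos: "0 < c"
    and S_measurable [measurable]: "\<And>f. (\<lambda>z. S z f) \<in> borel_measurable M"
    and S_linear: "\<And>z. z \<in> space M \<Longrightarrow> bounded_linear (S z)"
    and S_adjoint: "\<And>z f y. z \<in> space M \<Longrightarrow> S z f \<bullet> y = f \<bullet> \<Phi> z y"
    and \<Phi>_bound: "\<And>z y. z \<in> space M \<Longrightarrow> norm (\<Phi> z y) \<le> \<kappa> * norm y"
    and \<kappa>_nonneg: "0 \<le> \<kappa>" and lam_pos: "0 < lam"
begin

lemma F_continuous: "z \<in> space M \<Longrightarrow> continuous_on UNIV (F z)"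
  by (rule convex_continuous_quadratic_growth[OF F_convex F_nonneg F_growth c_pos])

lemma S_bound:
  assumes z: "z \<in> space M"
  shows "norm (S z f) \<le> \<kappa> * norm f"
proof (cases "S z f = 0")
  case False
  have "(norm (S z f))\<^sup>2 = f \<bullet> \<Phi> z (S z f)"
    using S_adjoint[OF z] by (simp add: power2_norm_eq_inner)
  also have "\<dots> \<le> norm f * norm (\<Phi> z (S z f))" by (rule norm_cauchy_schwarz)
  also have "\<dots> \<le> norm f * (\<kappa> * norm (S z f))" by (intro mult_left_mono \<Phi>_bound z) simp
  finally have "norm (S z f) * norm (S z f) \<le> (\<kappa> * norm f) * norm (S z f)"
    by (simp add: power2_eq_square mult_ac)
  then show ?thesis using False by simp
qed (simp add: \<kappa>_nonneg)

lemma S_diff: "z \<in> space M \<Longrightarrow> S z (f - g) = S z f - S z g"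
  by (rule linear_diff[OF bounded_linear.linear[OF S_linear]])

lemma \<Phi>_diff:
  assumes z: "z \<in> space M"
  shows "\<Phi> z (y - y') = \<Phi> z y - \<Phi> z y'"
proof -
  have "f \<bullet> \<Phi> z (y - y') = f \<bullet> (\<Phi> z y - \<Phi> z y')" for f
    unfolding inner_diff_right S_adjoint[OF z, symmetric] ..
  then show ?thesis by (metis vector_eq_rdot inner_commute)
qed

lemma \<Phi>_measurable:
  assumes [measurable]: "h \<in> borel_measurable M"
  shows "(\<lambda>z. \<Phi> z (h z)) \<in> borel_measurable M"
proof (rule borel_measurable_weakly)
  fix f
  have "(\<lambda>z. S z f \<bullet> h z) \<in> borel_measurable M" by measurable
  then show "(\<lambda>z. f \<bullet> \<Phi> z (h z)) \<in> borel_measurable M"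
    by (rule measurable_cong[THEN iffD1, rotated]) (rule S_adjoint)
qed

text \<open>The bound of \<open>subdifferential_resolvent_bound\<close> with the norm of
  \<open>S z f\<close> replaced by \<open>\<kappa> * r\<close>: one integrable majorant for all
  \<open>f\<close> of norm at most \<open>r\<close> and all regularization parameters.\<close>

definition W :: "real \<Rightarrow> 'z \<Rightarrow> real"
  where "W r z = 8 * c * (b z + 2 * c * (\<kappa> * r)\<^sup>2)"

lemma W_integrable: "integrable M (W r)"
  unfolding W_def using b_integrable by simp

lemma subgradient_bound:
  assumes z: "z \<in> space M" and y: "y \<in> subdifferential (F z) (S z f - e *\<^sub>R y)" and "0 \<le> e" "norm f \<le> r"
  shows "(norm y)\<^sup>2 \<le> W r z"
proof -
  have "norm (S z f) \<le> \<kappa> * r"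
    using S_bound[OF z, of f] mult_left_mono[OF \<open>norm f \<le> r\<close> \<kappa>_nonneg] by linarith
  then have "(norm (S z f))\<^sup>2 \<le> (\<kappa> * r)\<^sup>2" by (intro power_mono) auto
  then have "8 * c * (b z + 2 * c * (norm (S z f))\<^sup>2) \<le> W r z"
    unfolding W_def using c_pos by simp
  then show ?thesis
    using subdifferential_resolvent_bound[OF y \<open>0 \<le> e\<close> F_nonneg[OF z] F_growth[OF z] c_pos] by linarith
qed

lemma square_bounded_integrable:
  fixes h :: "'z \<Rightarrow> 'g"
  assumes [measurable]: "h \<in> borel_measurable M"
    and h: "AE z in M. (norm (h z))\<^sup>2 \<le> w z" and w: "integrable M w"
  shows "integrable M h" "integrable M (\<lambda>z. (norm (h z))\<^sup>2)" "integrable M (\<lambda>z. \<Phi> z (h z))"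
proof -
  show *: "integrable M h"
    by (rule Bochner_Integration.integrable_bound[of M "\<lambda>z. 1 + w z"])
       (use h w in \<open>auto intro: norm_le_of_sq[THEN order_trans] elim!: eventually_mono\<close>)
  show "integrable M (\<lambda>z. (norm (h z))\<^sup>2)"
    by (rule Bochner_Integration.integrable_bound[OF w]) (use h in \<open>auto elim!: eventually_mono\<close>)
  show "integrable M (\<lambda>z. \<Phi> z (h z))"
    by (rule Bochner_Integration.integrable_bound[of M "\<lambda>z. \<kappa> *\<^sub>R h z"])
       (use * \<Phi>_bound \<kappa>_nonneg in \<open>auto intro!: \<Phi>_measurable AE_I2\<close>)
qed

lemma inner_integral_\<Phi>:
  assumes "integrable M (\<lambda>z. \<Phi> z (h z))"
  shows "integrable M (\<lambda>z. h z \<bullet> S z f)" "(\<integral>z. \<Phi> z (h z) \<partial>M) \<bullet> f = (\<integral>z. h z \<bullet> S z f \<partial>M)"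
proof -
  have eq: "z \<in> space M \<Longrightarrow> \<Phi> z (h z) \<bullet> f = h z \<bullet> S z f" for z
    using S_adjoint[of z f "h z"] by (simp add: inner_commute)
  have "integrable M (\<lambda>z. \<Phi> z (h z) \<bullet> f)" using assms by simp
  then show "integrable M (\<lambda>z. h z \<bullet> S z f)"
    by (rule Bochner_Integration.integrable_cong[THEN iffD1, rotated -1]) (simp_all add: eq)
  have "(\<integral>z. \<Phi> z (h z) \<partial>M) \<bullet> f = (\<integral>z. \<Phi> z (h z) \<bullet> f \<partial>M)" using assms by simp
  also have "\<dots> = (\<integral>z. h z \<bullet> S z f \<partial>M)" by (rule Bochner_Integration.integral_cong) (simp_all add: eq)
  finally show "(\<integral>z. \<Phi> z (h z) \<partial>M) \<bullet> f = (\<integral>z. h z \<bullet> S z f \<partial>M)" .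
qed

lemma risk_integrable: "integrable M (\<lambda>z. F z (S z f))"
proof (rule Bochner_Integration.integrable_bound[of M "\<lambda>z. b z + c * (\<kappa> * norm f)\<^sup>2"])
  show "AE z in M. norm (F z (S z f)) \<le> norm (b z + c * (\<kappa> * norm f)\<^sup>2)"
  proof (rule AE_I2)
    fix z assume z: "z \<in> space M"
    have "c * (norm (S z f))\<^sup>2 \<le> c * (\<kappa> * norm f)\<^sup>2"
      using S_bound[OF z, of f] c_pos by (intro mult_left_mono power_mono) auto
    then show "norm (F z (S z f)) \<le> norm (b z + c * (\<kappa> * norm f)\<^sup>2)"
      using F_growth[OF z, of "S z f"] F_nonneg[OF z, of "S z f"] by simp
  qed
qed (use b_integrable in \<open>auto intro!: F_measurable\<close>)

section \<open>The regularized stationarity equation\<close>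

definition yosida_at :: "real \<Rightarrow> 'h \<Rightarrow> 'z \<Rightarrow> 'g"
  where "yosida_at e f z = yosida e (F z) (S z f)"

lemma yosida_at_subgradient:
  "z \<in> space M \<Longrightarrow> 0 < e \<Longrightarrow> yosida_at e f z \<in> subdifferential (F z) (S z f - e *\<^sub>R yosida_at e f z)"
  unfolding yosida_at_def by (rule yosida_in_subdifferential[OF F_convex F_continuous F_nonneg])

lemma yosida_at_measurable [measurable]: "0 < e \<Longrightarrow> yosida_at e f \<in> borel_measurable M"
  unfolding yosida_at_def[abs_def]
  by (rule borel_measurable_yosida[OF F_convex F_continuous F_nonneg]) (auto intro!: F_measurable)

lemma yosida_at_bound: "z \<in> space M \<Longrightarrow> 0 < e \<Longrightarrow> norm f \<le> r \<Longrightarrow> (norm (yosida_at e f z))\<^sup>2 \<le> W r z"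
  by (rule subgradient_bound[OF _ yosida_at_subgradient]) auto

lemma yosida_at_integrable:
  assumes "0 < e"
  shows "integrable M (yosida_at e f)" "integrable M (\<lambda>z. (norm (yosida_at e f z))\<^sup>2)"
    "integrable M (\<lambda>z. \<Phi> z (yosida_at e f z))"
  using square_bounded_integrable[OF yosida_at_measurable[OF assms] _ W_integrable[of "norm f"], of f]
  by (auto intro: yosida_at_bound assms)

lemma yosida_at_diff_integrable:
  assumes "0 < d" "0 < e"
  shows "integrable M (\<lambda>z. (norm (yosida_at d f z - yosida_at e g z))\<^sup>2)"
proof (rule square_bounded_integrable)
  show "(\<lambda>z. yosida_at d f z - yosida_at e g z) \<in> borel_measurable M" using assms by measurable
  show "AE z in M. (norm (yosida_at d f z - yosida_at e g z))\<^sup>2 \<le> 2 * (norm (yosida_at d f z))\<^sup>2 + 2 * (norm (yosida_at e g z))\<^sup>2"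
  proof (rule AE_I2)
    fix z
    have "0 \<le> (norm (yosida_at d f z + yosida_at e g z))\<^sup>2" by simp
    then show "(norm (yosida_at d f z - yosida_at e g z))\<^sup>2 \<le> 2 * (norm (yosida_at d f z))\<^sup>2 + 2 * (norm (yosida_at e g z))\<^sup>2"
      unfolding power2_norm_eq_inner by (simp add: inner_simps inner_commute)
  qed
qed (use yosida_at_integrable assms in auto)

text \<open>For positive \<open>e\<close> this is the gradient at \<open>f\<close> of the risk in
  which each \<open>F z\<close> is replaced by its Moreau envelope.\<close>

definition T :: "real \<Rightarrow> 'h \<Rightarrow> 'h"
  where "T e f = (\<integral>z. \<Phi> z (yosida_at e f z) \<partial>M)"

lemma T_diff_inner:
  assumes "0 < d" "0 < e"
  shows "integrable M (\<lambda>z. (yosida_at d f z - yosida_at e g z) \<bullet> S z k)"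
    "(T d f - T e g) \<bullet> k = (\<integral>z. (yosida_at d f z - yosida_at e g z) \<bullet> S z k \<partial>M)"
proof -
  note i = inner_integral_\<Phi>[OF yosida_at_integrable(3)]
  show "integrable M (\<lambda>z. (yosida_at d f z - yosida_at e g z) \<bullet> S z k)"
    unfolding inner_diff_left by (intro Bochner_Integration.integrable_diff i assms)
  show "(T d f - T e g) \<bullet> k = (\<integral>z. (yosida_at d f z - yosida_at e g z) \<bullet> S z k \<partial>M)"
    unfolding inner_diff_left T_def i(2)[OF assms(1)] i(2)[OF assms(2)]
    by (rule Bochner_Integration.integral_diff[symmetric]) (intro i assms)+
qed

lemma T_diff_monotone:
  assumes d: "0 < d" and e: "0 < e"
  shows "integrable M (\<lambda>z. (yosida_at d f z - yosida_at e g z) \<bullet> (d *\<^sub>R yosida_at d f z - e *\<^sub>R yosida_at e g z))"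
    "(\<integral>z. (yosida_at d f z - yosida_at e g z) \<bullet> (d *\<^sub>R yosida_at d f z - e *\<^sub>R yosida_at e g z) \<partial>M) \<le> (T d f - T e g) \<bullet> (f - g)"
proof -
  let ?u = "\<lambda>z. (yosida_at d f z - yosida_at e g z) \<bullet> (d *\<^sub>R yosida_at d f z - e *\<^sub>R yosida_at e g z)"
  \<comment> \<open>The identity expresses the inner product through squared norms already known to
    be integrable, so no Hoelder inequality is required.\<close>
  have eq: "?u = (\<lambda>z. ((d + e) * (norm (yosida_at d f z - yosida_at e g z))\<^sup>2 -
      (d - e) * ((norm (yosida_at e g z))\<^sup>2 - (norm (yosida_at d f z))\<^sup>2)) / 2)"
    by (rule ext) (simp add: two_parameter_identity)
  show i: "integrable M ?u"
    unfolding eq using yosida_at_diff_integrable[OF d e] yosida_at_integrable(2)[OF d] yosida_at_integrable(2)[OF e]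
    by simp
  have "(\<integral>z. ?u z \<partial>M) \<le> (\<integral>z. (yosida_at d f z - yosida_at e g z) \<bullet> S z (f - g) \<partial>M)"
    by (rule integral_mono[OF i T_diff_inner(1)[OF d e]])
       (simp add: S_diff resolvent_monotone[OF yosida_at_subgradient yosida_at_subgradient] d e)
  then show "(\<integral>z. ?u z \<partial>M) \<le> (T d f - T e g) \<bullet> (f - g)"
    using T_diff_inner(2)[OF d e] by simp
qed

lemma yosida_at_lipschitz:
  assumes z: "z \<in> space M" and e: "0 < e"
  shows "norm (yosida_at e f z - yosida_at e g z) \<le> \<kappa> * norm (f - g) / e"
proof (cases "yosida_at e f z = yosida_at e g z")
  case False
  let ?y = "yosida_at e f z - yosida_at e g z"
  have "e * (norm ?y)\<^sup>2 = ?y \<bullet> (e *\<^sub>R yosida_at e f z - e *\<^sub>R yosida_at e g z)"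
    unfolding power2_norm_eq_inner by (simp add: inner_simps algebra_simps)
  also have "\<dots> \<le> ?y \<bullet> S z (f - g)"
    unfolding S_diff[OF z] by (rule resolvent_monotone[OF yosida_at_subgradient yosida_at_subgradient]) (use z e in auto)
  also have "\<dots> \<le> norm ?y * norm (S z (f - g))" by (rule norm_cauchy_schwarz)
  also have "\<dots> \<le> norm ?y * (\<kappa> * norm (f - g))" by (intro mult_left_mono S_bound z) auto
  finally have "norm ?y * (e * norm ?y) \<le> norm ?y * (\<kappa> * norm (f - g))"
    by (simp add: power2_eq_square mult_ac)
  then have "e * norm ?y \<le> \<kappa> * norm (f - g)" using False by simp
  then show ?thesis using e by (simp add: field_simps)
qed (use \<kappa>_nonneg e in simp)

text \<open>One factor \<open>\<kappa>\<close> comes from evaluation, the other from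
  \<open>\<Phi>\<close>, and \<open>1 / e\<close> from the Yosida approximation.\<close>

lemma T_lipschitz:
  assumes e: "0 < e"
  shows "norm (T e f - T e g) \<le> \<kappa> * (\<kappa> / e) * norm (f - g)"
proof -
  have "T e f - T e g = (\<integral>z. \<Phi> z (yosida_at e f z) - \<Phi> z (yosida_at e g z) \<partial>M)"
    unfolding T_def using yosida_at_integrable(3)[OF e] by simp
  also have "norm \<dots> \<le> (\<integral>z. norm (\<Phi> z (yosida_at e f z) - \<Phi> z (yosida_at e g z)) \<partial>M)"
    by (rule integral_norm_bound)
  also have "\<dots> \<le> (\<integral>z. \<kappa> * (\<kappa> / e) * norm (f - g) \<partial>M)"
  proof (rule integral_mono)
    fix z assume z: "z \<in> space M"
    have "norm (\<Phi> z (yosida_at e f z) - \<Phi> z (yosida_at e g z)) \<le> \<kappa> * norm (yosida_at e f z - yosida_at e g z)"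
      unfolding \<Phi>_diff[OF z, symmetric] by (rule \<Phi>_bound[OF z])
    also have "\<dots> \<le> \<kappa> * (\<kappa> * norm (f - g) / e)" by (intro mult_left_mono yosida_at_lipschitz z e \<kappa>_nonneg)
    finally show "norm (\<Phi> z (yosida_at e f z) - \<Phi> z (yosida_at e g z)) \<le> \<kappa> * (\<kappa> / e) * norm (f - g)"
      by (simp add: mult_ac)
  qed (use yosida_at_integrable(3)[OF e] in auto)
  also have "\<dots> = \<kappa> * (\<kappa> / e) * norm (f - g)" by (simp add: prob_space)
  finally show ?thesis .
qed

text \<open>The strong monotonicity constant \<open>2 * lam\<close> comes entirely from the
  regularization term; \<open>T e\<close> adds a nonnegative amount.\<close>

lemma regularized_zero_exists:
  assumes e: "0 < e"
  shows "\<exists>f. (2 * lam) *\<^sub>R f + T e f = 0"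
proof -
  let ?A = "\<lambda>f. (2 * lam) *\<^sub>R f + T e f"
  obtain f where "?A f = 0"
  proof (rule strongly_monotone_lipschitz_zero[of "2 * lam" ?A "2 * lam + \<kappa> * (\<kappa> / e)"])
    show "0 < 2 * lam" using lam_pos by simp
    fix f g
    have eq: "?A f - ?A g = (2 * lam) *\<^sub>R (f - g) + (T e f - T e g)" by (simp add: algebra_simps)
    have "0 \<le> (\<integral>z. (yosida_at e f z - yosida_at e g z) \<bullet> (e *\<^sub>R yosida_at e f z - e *\<^sub>R yosida_at e g z) \<partial>M)"
      using e by (intro integral_nonneg_AE AE_I2) (simp flip: scaleR_diff_right)
    also have "\<dots> \<le> (T e f - T e g) \<bullet> (f - g)" by (rule T_diff_monotone(2)[OF e e])
    finally show "2 * lam * (norm (f - g))\<^sup>2 \<le> (?A f - ?A g) \<bullet> (f - g)"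
      unfolding eq inner_add_left by (simp add: power2_norm_eq_inner)
    have "norm (?A f - ?A g) \<le> 2 * lam * norm (f - g) + norm (T e f - T e g)"
      unfolding eq using norm_triangle_ineq[of "(2 * lam) *\<^sub>R (f - g)" "T e f - T e g"] lam_pos by simp
    then show "norm (?A f - ?A g) \<le> (2 * lam + \<kappa> * (\<kappa> / e)) * norm (f - g)"
      using T_lipschitz[OF e, of f g] by (simp add: algebra_simps)
  qed blast
  then show ?thesis by blast
qed

text \<open>Test the equation with \<open>f\<close> and use the subgradient inequality at the point
  0. The terms \<open>e * (?y \<bullet> ?y)\<close> and \<open>F z (S z f - e *\<^sub>R ?y)\<close>
  have a favourable sign, so the bound is uniform in \<open>e\<close>.\<close>

lemma regularized_zero_bound:
  assumes e: "0 < e" and f: "(2 * lam) *\<^sub>R f + T e f = 0"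
  shows "2 * lam * (norm f)\<^sup>2 \<le> (\<integral>z. F z 0 \<partial>M)"
proof -
  have z0: "integrable M (\<lambda>z. F z 0)"
  proof -
    have "z \<in> space M \<Longrightarrow> F z (S z 0) = F z 0" for z
      by (simp add: linear_0[OF bounded_linear.linear[OF S_linear]])
    then show ?thesis using risk_integrable[of 0] by (simp cong: Bochner_Integration.integrable_cong)
  qed
  note i = inner_integral_\<Phi>[OF yosida_at_integrable(3)[OF e, of f], of f]
  have "(2 * lam) *\<^sub>R f = - T e f" using f by (simp add: eq_neg_iff_add_eq_0)
  then have "2 * lam * (f \<bullet> f) = - (T e f \<bullet> f)" by (metis inner_minus_left inner_scaleR_left)
  also have "\<dots> = (\<integral>z. - (yosida_at e f z \<bullet> S z f) \<partial>M)" unfolding T_def i(2) by simp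
  also have "\<dots> \<le> (\<integral>z. F z 0 \<partial>M)"
  proof (rule integral_mono)
    fix z assume z: "z \<in> space M"
    let ?y = "yosida_at e f z"
    have "F z (S z f - e *\<^sub>R ?y) + ?y \<bullet> (0 - (S z f - e *\<^sub>R ?y)) \<le> F z 0"
      using yosida_at_subgradient[OF z e, of f] unfolding subdifferential_def mem_Collect_eq by blast
    moreover have "?y \<bullet> (0 - (S z f - e *\<^sub>R ?y)) = e * (?y \<bullet> ?y) - ?y \<bullet> S z f"
      by (simp add: inner_diff_right)
    moreover have "0 \<le> e * (?y \<bullet> ?y)" using e by simp
    ultimately show "- (?y \<bullet> S z f) \<le> F z 0"
      using F_nonneg[OF z, of "S z f - e *\<^sub>R ?y"] by linarith
  qed (use i z0 in auto)
  finally show ?thesis by (simp add: power2_norm_eq_inner)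
qed

text \<open>The integrated analogue of \<open>two_parameter_estimate\<close>. Since \<open>f\<close>
  and \<open>g\<close> differ, the inner product need not be nonpositive at each point, but its
  integral is: by the two equations it is at most
  \<open>- (2 * lam * (norm (f - g))\<^sup>2)\<close>.\<close>

lemma regularized_zero_L2_increment:
  assumes e: "0 < e" and d: "e < d"
    and f: "(2 * lam) *\<^sub>R f + T d f = 0" and g: "(2 * lam) *\<^sub>R g + T e g = 0"
  shows "(\<integral>z. (norm (yosida_at d f z - yosida_at e g z))\<^sup>2 \<partial>M) \<le>
    (\<integral>z. (norm (yosida_at e g z))\<^sup>2 \<partial>M) - (\<integral>z. (norm (yosida_at d f z))\<^sup>2 \<partial>M)"
proof -
  have d0: "0 < d" using e d by simp
  let ?D = "\<integral>z. (norm (yosida_at d f z - yosida_at e g z))\<^sup>2 \<partial>M"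
  let ?a = "\<integral>z. (norm (yosida_at d f z))\<^sup>2 \<partial>M" and ?b = "\<integral>z. (norm (yosida_at e g z))\<^sup>2 \<partial>M"
  note I = yosida_at_diff_integrable[OF d0 e, of f g] yosida_at_integrable(2)[OF d0, of f] yosida_at_integrable(2)[OF e, of g]
    T_diff_monotone(1)[OF d0 e, of f g]
  let ?u = "\<integral>z. (yosida_at d f z - yosida_at e g z) \<bullet> (d *\<^sub>R yosida_at d f z - e *\<^sub>R yosida_at e g z) \<partial>M"
  have "T d f - T e g = - ((2 * lam) *\<^sub>R (f - g))"
    using f g unfolding add.commute[of _ "T _ _"] by (simp add: scaleR_diff_right add_eq_0_iff)
  then have "(T d f - T e g) \<bullet> (f - g) = - (2 * lam * (norm (f - g))\<^sup>2)"
    by (simp add: power2_norm_eq_inner)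
  also have "\<dots> \<le> 0" using lam_pos by simp
  finally have u: "?u \<le> 0" using T_diff_monotone(2)[OF d0 e, of f g] by linarith
  have "(d + e) * ?D = (\<integral>z. (d + e) * (norm (yosida_at d f z - yosida_at e g z))\<^sup>2 \<partial>M)" by simp
  also have "\<dots> = (\<integral>z. (d - e) * ((norm (yosida_at e g z))\<^sup>2 - (norm (yosida_at d f z))\<^sup>2) +
      2 * ((yosida_at d f z - yosida_at e g z) \<bullet> (d *\<^sub>R yosida_at d f z - e *\<^sub>R yosida_at e g z)) \<partial>M)"
    unfolding two_parameter_identity ..
  also have "\<dots> = (d - e) * (?b - ?a) + 2 * ?u" using I by simp
  finally have "(d + e) * ?D \<le> (d - e) * (?b - ?a)" using u by simp
  moreover have "0 \<le> ?D" by simp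
  then have "(d - e) * ?D \<le> (d + e) * ?D" using e by (intro mult_right_mono) auto
  ultimately have "(d - e) * ?D \<le> (d - e) * (?b - ?a)" by linarith
  then show ?thesis using d by simp
qed

section \<open>Passage to the limit and sufficiency of stationarity\<close>

lemma subgradient_selection_exists:
  obtains f h where "h \<in> borel_measurable M" "integrable M (\<lambda>z. (norm (h z))\<^sup>2)"
    "\<And>z. z \<in> space M \<Longrightarrow> h z \<in> subdifferential (F z) (S z f)"
    "f = - (1 / (2 * lam)) *\<^sub>R (\<integral>z. \<Phi> z (h z) \<partial>M)"
proof -
  define e where "e n = 1 / real (Suc n)" for n
  have e: "0 < e n" for n by (simp add: e_def)
  have e0: "e \<longlonglongrightarrow> 0" unfolding e_def by (rule LIMSEQ_Suc[OF lim_1_over_n])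
  obtain f where f: "\<And>n. (2 * lam) *\<^sub>R f n + T (e n) (f n) = 0"
    using regularized_zero_exists[OF e] by metis
  \<comment> \<open>The a priori bound solved for the norm; being independent of \<open>n\<close>,
    it makes \<open>W r\<close> dominate all squared norms of the \<open>h n\<close>.\<close>
  define r where "r = sqrt ((\<integral>z. F z 0 \<partial>M) / (2 * lam))"
  have r: "norm (f n) \<le> r" for n
    unfolding r_def using regularized_zero_bound[OF e f, of n] lam_pos
    by (intro real_le_rsqrt) (simp add: field_simps)
  define h where "h n = yosida_at (e n) (f n)" for n
  have h_sub: "h n z \<in> subdifferential (F z) (S z (f n) - e n *\<^sub>R h n z)" if "z \<in> space M" for n z
    unfolding h_def by (rule yosida_at_subgradient[OF that e])
  have hW: "(norm (h n z))\<^sup>2 \<le> W r z" if "z \<in> space M" for n z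
    unfolding h_def by (rule yosida_at_bound[OF that e r])
  have [measurable]: "h n \<in> borel_measurable M" for n unfolding h_def using e by measurable
  have h_int: "integrable M (h n)" "integrable M (\<lambda>z. (norm (h n z))\<^sup>2)" "integrable M (\<lambda>z. \<Phi> z (h n z))" for n
    unfolding h_def using yosida_at_integrable[OF e] by auto
  have hd_int: "integrable M (\<lambda>z. (norm (h n z - h m z))\<^sup>2)" for n m
    unfolding h_def by (rule yosida_at_diff_integrable[OF e e])
  have L2: "\<exists>N. \<forall>i\<ge>N. \<forall>j\<ge>N. (\<integral>z. (norm (h i z - h j z))\<^sup>2 \<partial>M) < \<eta>" if "0 < \<eta>" for \<eta>
  proof (rule increment_bound_Cauchy)
    show "(\<integral>z. (norm (h n z - h m z))\<^sup>2 \<partial>M) \<le> (\<integral>z. (norm (h m z))\<^sup>2 \<partial>M) - (\<integral>z. (norm (h n z))\<^sup>2 \<partial>M)"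
      if "n < m" for n m
      unfolding h_def by (rule regularized_zero_L2_increment[OF e _ f f]) (use that in \<open>simp add: e_def frac_less2\<close>)
    show "(\<integral>z. (norm (h n z))\<^sup>2 \<partial>M) \<le> (\<integral>z. W r z \<partial>M)" for n
      by (rule integral_mono[OF h_int(2) W_integrable hW])
  qed (use that in \<open>auto simp: norm_minus_commute\<close>)
  \<comment> \<open>Almost everywhere convergence of a subsequence is drawn from the L1 Cauchy
    property. Since \<open>M\<close> has mass 1, integrating
    \<open>a \<le> \<eta> / 2 + a\<^sup>2 / (2 * \<eta>)\<close> carries the L2 property
    over.\<close>
  have L1: "\<exists>N. \<forall>i\<ge>N. \<forall>j\<ge>N. (\<integral>z. norm (h i z - h j z) \<partial>M) < \<eta>" if \<eta>: "0 < \<eta>" for \<eta>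
  proof -
    obtain N where N: "\<And>i j. N \<le> i \<Longrightarrow> N \<le> j \<Longrightarrow> (\<integral>z. (norm (h i z - h j z))\<^sup>2 \<partial>M) < \<eta>\<^sup>2"
      using L2[of "\<eta>\<^sup>2"] \<eta> by auto
    have "(\<integral>z. norm (h i z - h j z) \<partial>M) < \<eta>" if "N \<le> i" "N \<le> j" for i j
    proof -
      have "(\<integral>z. norm (h i z - h j z) \<partial>M) \<le> (\<integral>z. \<eta> / 2 + (norm (h i z - h j z))\<^sup>2 / (2 * \<eta>) \<partial>M)"
      proof (rule integral_mono)
        fix z
        have "0 \<le> (norm (h i z - h j z) - \<eta>)\<^sup>2" by simp
        then show "norm (h i z - h j z) \<le> \<eta> / 2 + (norm (h i z - h j z))\<^sup>2 / (2 * \<eta>)"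
          using \<eta> unfolding power2_diff by (simp add: field_simps power2_eq_square)
      qed (use h_int hd_int[of i j] in auto)
      also have "\<dots> = \<eta> / 2 + (\<integral>z. (norm (h i z - h j z))\<^sup>2 \<partial>M) / (2 * \<eta>)"
        using hd_int[of i j] by (simp add: prob_space)
      also have "\<dots> < \<eta> / 2 + \<eta>\<^sup>2 / (2 * \<eta>)"
        using N[OF that] \<eta> by (intro add_strict_left_mono divide_strict_right_mono) auto
      also have "\<dots> = \<eta>" using \<eta> by (simp add: power2_eq_square)
      finally show ?thesis .
    qed
    then show ?thesis by blast
  qed
  obtain q where q: "strict_mono q" and AE_Cauchy: "AE z in M. Cauchy (\<lambda>i. h (q i) z)"
    by (rule cauchy_L1_AE_cauchy_subseq[OF h_int(1) L1]) blast+
  define C where "C z \<longleftrightarrow> Cauchy (\<lambda>i. h (q i) z)" for z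
  have [measurable]: "Measurable.pred M C"
    unfolding C_def pred_def by measurable
  \<comment> \<open>Off \<open>C\<close> this is only the default value of \<open>lim\<close>;
    nothing but its measurability is used there.\<close>
  define l where "l z = lim (\<lambda>i. h (q i) z)" for z
  have [measurable]: "l \<in> borel_measurable M" unfolding l_def by measurable
  have l: "(\<lambda>i. h (q i) z) \<longlonglongrightarrow> l z" if "C z" for z
    using that Cauchy_convergent convergent_LIMSEQ_iff unfolding C_def l_def by blast
  have AE_l: "AE z in M. (\<lambda>i. h (q i) z) \<longlonglongrightarrow> l z"
    using AE_Cauchy by eventually_elim (simp add: C_def l)
  \<comment> \<open>Each \<open>f n\<close> is recovered from \<open>h n\<close> by its equation, so
    convergence of the \<open>h (q i)\<close> and dominated convergence already force convergence of
    \<open>f (q i)\<close> in norm.\<close>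
  define fs where "fs = - (1 / (2 * lam)) *\<^sub>R (\<integral>z. \<Phi> z (l z) \<partial>M)"
  have fq: "(\<lambda>i. f (q i)) \<longlonglongrightarrow> fs"
  proof -
    have "(\<lambda>i. \<integral>z. \<Phi> z (h (q i) z) \<partial>M) \<longlonglongrightarrow> (\<integral>z. \<Phi> z (l z) \<partial>M)"
    proof (rule integral_dominated_convergence)
      show "integrable M (\<lambda>z. \<kappa> * (1 + W r z))" using W_integrable by simp
      show "AE z in M. norm (\<Phi> z (h (q i) z)) \<le> \<kappa> * (1 + W r z)" for i
        using \<Phi>_bound[of _ "h (q i) _"] norm_le_of_sq[OF hW, of _ "q i"] \<kappa>_nonneg
        by (intro AE_I2) (meson mult_left_mono order_trans)
      show "AE z in M. (\<lambda>i. \<Phi> z (h (q i) z)) \<longlonglongrightarrow> \<Phi> z (l z)"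
        using AE_l AE_space
      proof eventually_elim
        fix z assume lim: "(\<lambda>i. h (q i) z) \<longlonglongrightarrow> l z" and z: "z \<in> space M"
        have "(\<lambda>i. \<kappa> * norm (h (q i) z - l z)) \<longlonglongrightarrow> \<kappa> * norm (l z - l z)"
          by (intro tendsto_intros lim)
        then have "(\<lambda>i. \<kappa> * norm (h (q i) z - l z)) \<longlonglongrightarrow> 0" by simp
        then have "(\<lambda>i. \<Phi> z (h (q i) z) - \<Phi> z (l z)) \<longlonglongrightarrow> 0"
          by (rule Lim_null_comparison[rotated])
             (auto simp flip: \<Phi>_diff[OF z] intro!: \<Phi>_bound z always_eventually)
        then show "(\<lambda>i. \<Phi> z (h (q i) z)) \<longlonglongrightarrow> \<Phi> z (l z)" by (rule LIM_zero_cancel)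
      qed
    qed (auto intro: \<Phi>_measurable)
    then have "(\<lambda>i. - (1 / (2 * lam)) *\<^sub>R (\<integral>z. \<Phi> z (h (q i) z) \<partial>M)) \<longlonglongrightarrow> fs"
      unfolding fs_def by (intro tendsto_intros)
    moreover have "- (1 / (2 * lam)) *\<^sub>R (\<integral>z. \<Phi> z (h i z) \<partial>M) = f i" for i
    proof -
      have "(2 * lam) *\<^sub>R f i = - (\<integral>z. \<Phi> z (h i z) \<partial>M)"
        using f[of i] unfolding T_def h_def by (simp add: eq_neg_iff_add_eq_0)
      then have "(1 / (2 * lam)) *\<^sub>R (2 * lam) *\<^sub>R f i = (1 / (2 * lam)) *\<^sub>R - (\<integral>z. \<Phi> z (h i z) \<partial>M)"
        by (simp only:)
      then show ?thesis using lam_pos by simp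
    qed
    ultimately show ?thesis by simp
  qed
  \<comment> \<open>The subgradient condition must hold everywhere, so on the null set without a limit \<open>H\<close> is taken from
    the Yosida approximations at \<open>fs\<close>, which converge at every point.\<close>
  define v where "v z = lim (\<lambda>n. yosida_at (e n) fs z)" for z
  have [measurable]: "v \<in> borel_measurable M" unfolding v_def using e by measurable
  have v: "(\<lambda>n. yosida_at (e n) fs z) \<longlonglongrightarrow> v z" if z: "z \<in> space M" for z
    using yosida_Cauchy[OF F_convex[OF z] F_nonneg[OF z] F_growth[OF z] c_pos, of "S z fs"]
      Cauchy_convergent convergent_LIMSEQ_iff
    unfolding v_def yosida_at_def e_def by blast
  define H where "H z = (if C z then l z else v z)" for z
  have [measurable]: "H \<in> borel_measurable M" unfolding H_def by measurable
  have H: "H z \<in> subdifferential (F z) (S z fs)" if z: "z \<in> space M" for z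
  proof (cases "C z")
    case True
    have "(\<lambda>i. S z (f (q i))) \<longlonglongrightarrow> S z fs"
      by (rule bounded_linear.tendsto[OF S_linear[OF z] fq])
    moreover have "(\<lambda>i. e (q i)) \<longlonglongrightarrow> 0"
      using LIMSEQ_subseq_LIMSEQ[OF e0 q] by (simp add: comp_def)
    ultimately have "l z \<in> subdifferential (F z) (S z fs)"
      by (rule subdifferential_resolvent_limit[OF F_continuous[OF z] h_sub[OF z] l[OF True]])
    then show ?thesis using True by (simp add: H_def)
  next
    case False
    have "v z \<in> subdifferential (F z) (S z fs)"
      by (rule subdifferential_resolvent_limit[OF F_continuous[OF z] yosida_at_subgradient[OF z e] v[OF z] tendsto_const e0])
    then show ?thesis using False by (simp add: H_def)
  qed
  have "(\<integral>z. \<Phi> z (H z) \<partial>M) = (\<integral>z. \<Phi> z (l z) \<partial>M)"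
    by (rule integral_cong_AE) (use AE_Cauchy in \<open>auto intro!: \<Phi>_measurable simp: H_def C_def elim!: eventually_mono\<close>)
  then have "fs = - (1 / (2 * lam)) *\<^sub>R (\<integral>z. \<Phi> z (H z) \<partial>M)" by (simp add: fs_def)
  moreover have "integrable M (\<lambda>z. (norm (H z))\<^sup>2)"
    by (rule square_bounded_integrable(2)[OF _ _ W_integrable[of "norm fs"]])
       (use H in \<open>auto intro!: AE_I2 subgradient_bound[of _ _ _ 0]\<close>)
  ultimately show ?thesis using H that[of H fs] by simp
qed

text \<open>Integrating the subgradient inequality bounds the risk difference below by
  \<open>- (2 * lam * (f \<bullet> (g - f)))\<close>, which is the linear part of the expansion of
  \<open>lam * (norm g)\<^sup>2\<close> around \<open>f\<close> with opposite sign. The surviving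
  square gives uniqueness along with minimality.\<close>

lemma subgradient_selection_minimizes:
  assumes h: "h \<in> borel_measurable M" "integrable M (\<lambda>z. (norm (h z))\<^sup>2)"
    and sub: "\<And>z. z \<in> space M \<Longrightarrow> h z \<in> subdifferential (F z) (S z f)"
    and f: "f = - (1 / (2 * lam)) *\<^sub>R (\<integral>z. \<Phi> z (h z) \<partial>M)"
  shows "(\<integral>z. F z (S z f) \<partial>M) + lam * (norm f)\<^sup>2 + lam * (norm (g - f))\<^sup>2 \<le>
    (\<integral>z. F z (S z g) \<partial>M) + lam * (norm g)\<^sup>2"
proof -
  have "integrable M (\<lambda>z. \<Phi> z (h z))"
    by (rule square_bounded_integrable(3)[OF h(1) _ h(2)]) simp
  note i = inner_integral_\<Phi>[OF this]
  have "(2 * lam) *\<^sub>R f = - (\<integral>z. \<Phi> z (h z) \<partial>M)" using f lam_pos by simp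
  then have "- (2 * lam * (f \<bullet> (g - f))) = (\<integral>z. \<Phi> z (h z) \<partial>M) \<bullet> (g - f)"
    by (metis inner_minus_left inner_scaleR_left minus_minus)
  also have "\<dots> = (\<integral>z. h z \<bullet> S z (g - f) \<partial>M)" by (rule i(2))
  also have "\<dots> \<le> (\<integral>z. F z (S z g) - F z (S z f) \<partial>M)"
  proof (rule integral_mono[OF i(1)])
    show "h z \<bullet> S z (g - f) \<le> F z (S z g) - F z (S z f)" if "z \<in> space M" for z
      using sub[OF that] by (auto simp: subdifferential_def S_diff[OF that] le_diff_eq add.commute)
  qed (simp add: risk_integrable)
  also have "\<dots> = (\<integral>z. F z (S z g) \<partial>M) - (\<integral>z. F z (S z f) \<partial>M)"
    by (simp add: risk_integrable)
  finally have "(\<integral>z. F z (S z f) \<partial>M) \<le> (\<integral>z. F z (S z g) \<partial>M) + 2 * lam * (f \<bullet> (g - f))" by simp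
  moreover have "lam * (norm f)\<^sup>2 + lam * (norm (g - f))\<^sup>2 = lam * (norm g)\<^sup>2 - 2 * lam * (f \<bullet> (g - f))"
    unfolding power2_norm_eq_inner by (simp add: inner_diff inner_commute algebra_simps)
  ultimately show ?thesis by linarith
qed

end

section \<open>The representer theorem\<close>

lemma feature_map_adjoint:
  assumes "rkhs MX eval_h" "x \<in> space MX"
  shows "eval_h f x \<bullet> y = f \<bullet> feature_map eval_h x y"
  unfolding feature_map_def using assms
  by (intro adjoint_characterization) (simp add: rkhs_def)

text \<open>Makes the kernel a bounded linear operator, so that \<open>onorm\<close> really bounds
  its values.\<close>

lemma bounded_linear_feature_map:
  assumes r: "rkhs MX eval_h" and x: "x \<in> space MX"
  shows "bounded_linear (feature_map eval_h x)"
proof -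
  let ?P = "feature_map eval_h x"
  note adj = feature_map_adjoint[OF r x]
  obtain K where K: "\<And>f. norm (eval_h f x) \<le> norm f * K" "0 < K"
    using r x bounded_linear.pos_bounded unfolding rkhs_def by metis
  have eqI: "u = v" if "\<And>f. f \<bullet> u = f \<bullet> v" for u v :: 'b
    using that by (metis vector_eq_rdot inner_commute)
  show ?thesis
  proof (rule bounded_linear_intro)
    show "?P (y + y') = ?P y + ?P y'" for y y'
      by (rule eqI) (simp add: inner_add_right flip: adj)
    show "?P (s *\<^sub>R y) = s *\<^sub>R ?P y" for s y
      by (rule eqI) (simp flip: adj)
    show "norm (?P y) \<le> norm y * K" for y
    proof (cases "?P y = 0")
      case False
      have "norm (?P y) * norm (?P y) = eval_h (?P y) x \<bullet> y"
        by (simp add: adj power2_norm_eq_inner flip: power2_eq_square)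
      also have "\<dots> \<le> norm (eval_h (?P y) x) * norm y" by (rule norm_cauchy_schwarz)
      also have "\<dots> \<le> (norm (?P y) * K) * norm y" by (intro mult_right_mono K) auto
      finally have "norm (?P y) * norm (?P y) \<le> norm (?P y) * (norm y * K)" by (simp add: mult_ac)
      then show ?thesis using False by simp
    qed (use K in simp)
  qed
qed

text \<open>By adjointness the squared norm of the feature vector is
  \<open>kernel eval_h x x y \<bullet> y\<close>; this is where the square root in the definition of
  a bounded kernel comes from.\<close>

lemma norm_feature_map_le:
  assumes r: "rkhs MX eval_h" and x: "x \<in> space MX"
    and k: "sqrt (onorm (kernel eval_h x x)) \<le> \<kappa>"
  shows "norm (feature_map eval_h x y) \<le> \<kappa> * norm y"
proof -
  let ?P = "feature_map eval_h x"
  have "bounded_linear (\<lambda>f. eval_h f x)" using r x by (simp add: rkhs_def)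
  then have K: "bounded_linear (kernel eval_h x x)"
    unfolding kernel_def comp_def by (rule bounded_linear_compose[OF _ bounded_linear_feature_map[OF r x]])
  note pos = onorm_pos_le[OF K]
  have "(norm (?P y))\<^sup>2 = kernel eval_h x x y \<bullet> y"
    by (simp add: kernel_def feature_map_adjoint[OF r x] power2_norm_eq_inner)
  also have "\<dots> \<le> norm (kernel eval_h x x y) * norm y" by (rule norm_cauchy_schwarz)
  also have "\<dots> \<le> (onorm (kernel eval_h x x) * norm y) * norm y"
    by (intro mult_right_mono onorm[OF K]) auto
  also have "\<dots> = (sqrt (onorm (kernel eval_h x x)) * norm y)\<^sup>2"
    using pos by (simp add: power_mult_distrib power2_eq_square)
  finally have "norm (?P y) \<le> sqrt (onorm (kernel eval_h x x)) * norm y"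
    by (rule power2_le_imp_le) (use pos in auto)
  also have "\<dots> \<le> \<kappa> * norm y" by (intro mult_right_mono k) auto
  finally show ?thesis .
qed

text \<open>Along the direction of \<open>v\<close> the loss rises with slope at least
  \<open>norm v\<close>. A step of length \<open>2 * a\<close> is the longest that the supremum
  admits, and it is nonzero because \<open>a\<close> is positive.\<close>

lemma norm_subgradient_le_lip_const:
  assumes v: "v \<in> subdifferential (L x y) t" and x: "x \<in> space MX" and y: "y \<in> Y" and a: "0 < a"
  shows "ennreal (norm v) \<le> lip_const MX Y L a"
proof (cases "v = 0")
  case False
  define s where "s = t + (2 * a) *\<^sub>R sgn v"
  have st: "s - t = (2 * a) *\<^sub>R sgn v" by (simp add: s_def)
  then have n: "norm (s - t) = 2 * a" using a False by (simp add: norm_sgn)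
  have "v \<bullet> (s - t) = 2 * a * norm v"
    unfolding st using False by (simp add: sgn_div_norm power2_norm_eq_inner[symmetric] power2_eq_square)
  moreover have "L x y t + v \<bullet> (s - t) \<le> L x y s" using v by (simp add: subdifferential_def)
  ultimately have "norm v * (2 * a) \<le> \<bar>L x y s - L x y t\<bar>" by (simp add: mult_ac)
  then have "norm v \<le> \<bar>L x y s - L x y t\<bar> / norm (s - t)" using a by (simp add: n pos_le_divide_eq)
  then have "ennreal (norm v) \<le> ennreal (\<bar>L x y s - L x y t\<bar> / norm (s - t))" by (rule ennreal_leI)
  also have "\<dots> \<le> (SUP (x, y) \<in> space MX \<times> Y. ennreal (\<bar>L x y s - L x y t\<bar> / norm (s - t)))"
    by (rule SUP_upper2[of "(x, y)"]) (use x y in auto)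
  also have "\<dots> \<le> lip_const MX Y L a"
    unfolding lip_const_def by (rule SUP_upper2[of "(s, t)"]) (use n a in auto)
  finally show ?thesis .
qed simp

theorem theoremC7:
  fixes MX :: "'x measure"
    and Y :: "'g::{real_inner, banach, second_countable_topology} set"
    and eval_h :: "'h::{real_inner, banach, second_countable_topology} \<Rightarrow> 'x \<Rightarrow> 'g"
    and L :: "'x \<Rightarrow> 'g \<Rightarrow> 'g \<Rightarrow> real"
    and J :: "('x \<times> 'g) measure"
    and lam :: real
  assumes "complete Y"
    and "rkhs MX eval_h"
    and "\<And>f. eval_h f \<in> borel_measurable MX"
    and "bounded_kernel MX eval_h"
    and "loss_function MX Y L"
    and "convex_loss MX Y L"
    and "prob_space J"
    and "sets J = sets (MX \<Otimes>\<^sub>M restrict_space borel Y)"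
    and "nemitski_loss2 MX Y J L"
    and "0 < lam"
  shows "(\<exists>!f. is_arg_min (reg_risk eval_h L J lam) (\<lambda>_. True) f) \<and>
    (\<exists>h. square_integrable J h \<and>
      (\<forall>x\<in>space MX. \<forall>y\<in>Y. h (x, y) \<in> subdifferential (L x y) (eval_h (reg_minimizer eval_h L J lam) x)) \<and>
      reg_minimizer eval_h L J lam = - (1 / (2 * lam)) *\<^sub>R integral_feature eval_h J h) \<and>
    (locally_lipschitz_loss MX Y L \<longrightarrow>
      (\<forall>h. square_integrable J h \<and>
        (\<forall>x\<in>space MX. \<forall>y\<in>Y. h (x, y) \<in> subdifferential (L x y) (eval_h (reg_minimizer eval_h L J lam) x)) \<and>
        reg_minimizer eval_h L J lam = - (1 / (2 * lam)) *\<^sub>R integral_feature eval_h J h \<longrightarrow>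
        (let B = sqrt (risk L J (\<lambda>_. 0) / lam) in
          (0 < B \<longrightarrow> sup_norm (space MX \<times> Y) h \<le> lip_const MX Y L B) \<and>
          (B = 0 \<longrightarrow> (\<forall>a>0. sup_norm (space MX \<times> Y) h \<le> lip_const MX Y L a)))))"
proof -
  interpret J: prob_space J by fact
  note rk = assms(2) and sJ = assms(8)
  have spJ: "space J = space MX \<times> Y"
    using sets_eq_imp_space_eq[OF sJ] by (simp add: space_pair_measure space_restrict_space)
  note [measurable_cong] = sJ
  obtain b c where b: "integrable J b" and c: "0 < c"
    and growth: "\<And>x y t. x \<in> space MX \<Longrightarrow> y \<in> Y \<Longrightarrow> L x y t \<le> b (x, y) + c * (norm t)\<^sup>2"
    using assms(9) unfolding nemitski_loss2_def by blast
  obtain \<kappa>0 where \<kappa>0: "\<And>x. x \<in> space MX \<Longrightarrow> sqrt (onorm (kernel eval_h x x)) \<le> \<kappa>0"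
    using assms(4) unfolding bounded_kernel_def bdd_above_def by blast
  define \<kappa> where "\<kappa> = max 0 \<kappa>0"
  have \<kappa>: "sqrt (onorm (kernel eval_h x x)) \<le> \<kappa>" if "x \<in> space MX" for x
    using \<kappa>0[OF that] by (simp add: \<kappa>_def)
  have L_meas: "(\<lambda>(x, y, t). L x y t) \<in> borel_measurable (MX \<Otimes>\<^sub>M (restrict_space borel Y \<Otimes>\<^sub>M borel))"
    and L_pos: "\<And>x y t. x \<in> space MX \<Longrightarrow> y \<in> Y \<Longrightarrow> 0 \<le> L x y t"
    using assms(5) by (auto simp: loss_function_def)
  let ?F = "\<lambda>z. L (fst z) (snd z)" and ?S = "\<lambda>z f. eval_h f (fst z)" and ?P = "\<lambda>z. feature_map eval_h (fst z)"
  have fst_meas: "fst \<in> measurable J MX"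
    and snd_meas: "snd \<in> measurable J (restrict_space borel Y)"
    by (auto simp: measurable_cong_sets[OF sJ refl])
  interpret convex_integral_problem J ?F ?S ?P b c \<kappa> lam
  proof (intro convex_integral_problem.intro convex_integral_problem_axioms.intro)
    show "prob_space J" by fact
  next
    fix t :: "'x \<times> 'g \<Rightarrow> 'g" assume "t \<in> borel_measurable J"
    then have "(\<lambda>z. (fst z, snd z, t z)) \<in> measurable J (MX \<Otimes>\<^sub>M (restrict_space borel Y \<Otimes>\<^sub>M borel))"
      by (intro measurable_Pair fst_meas snd_meas)
    from measurable_compose[OF this L_meas] show "(\<lambda>z. ?F z (t z)) \<in> borel_measurable J" by simp
  next
    show "(\<lambda>z. ?S z f) \<in> borel_measurable J" for f
      by (rule measurable_compose[OF fst_meas assms(3)])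
  next
    fix z assume "z \<in> space J"
    then have x: "fst z \<in> space MX" and y: "snd z \<in> Y" by (auto simp: spJ)
    show "convex_on UNIV (?F z)" using assms(6) x y by (simp add: convex_loss_def)
    show "0 \<le> ?F z s" for s by (rule L_pos[OF x y])
    show "?F z s \<le> b z + c * (norm s)\<^sup>2" for s using growth[OF x y] by simp
    show "bounded_linear (?S z)" using rk x by (simp add: rkhs_def)
    show "?S z f \<bullet> y = f \<bullet> ?P z y" for f y by (rule feature_map_adjoint[OF rk x])
    show "norm (?P z y) \<le> \<kappa> * norm y" for y by (rule norm_feature_map_le[OF rk x \<kappa>[OF x]])
  qed (use b c assms(10) in \<open>auto simp: \<kappa>_def\<close>)
  have risk_eq: "reg_risk eval_h L J lam g = (\<integral>z. ?F z (?S z g) \<partial>J) + lam * (norm g)\<^sup>2" for g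
    by (simp add: reg_risk_def risk_def case_prod_beta')
  have int_eq: "integral_feature eval_h J h = (\<integral>z. ?P z (h z) \<partial>J)" for h
    by (simp add: integral_feature_def case_prod_beta')
  obtain f h where h: "h \<in> borel_measurable J" "integrable J (\<lambda>z. (norm (h z))\<^sup>2)"
      "\<And>z. z \<in> space J \<Longrightarrow> h z \<in> subdifferential (?F z) (?S z f)"
    and f: "f = - (1 / (2 * lam)) *\<^sub>R (\<integral>z. ?P z (h z) \<partial>J)"
    by (rule subgradient_selection_exists) blast
  have min: "reg_risk eval_h L J lam f + lam * (norm (g - f))\<^sup>2 \<le> reg_risk eval_h L J lam g" for g
    unfolding risk_eq by (rule subgradient_selection_minimizes[OF h f])
  \<comment> \<open>Reduces the predicate to equality with \<open>f\<close>, which settles unique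
    existence and the choice inside \<open>arg_min\<close> at once.\<close>
  have argmin: "is_arg_min (reg_risk eval_h L J lam) (\<lambda>_. True) g \<longleftrightarrow> g = f" for g
  proof
    assume "is_arg_min (reg_risk eval_h L J lam) (\<lambda>_. True) g"
    then have "reg_risk eval_h L J lam g \<le> reg_risk eval_h L J lam f"
      by (auto simp: is_arg_min_def not_less)
    then have "lam * (norm (g - f))\<^sup>2 \<le> 0" using min[of g] by linarith
    then show "g = f" using assms(10) by (simp add: mult_le_0_iff)
  next
    have "reg_risk eval_h L J lam f \<le> reg_risk eval_h L J lam g" for g
      using min[of g] assms(10) zero_le_power2[of "norm (g - f)"] by (smt (verit) mult_nonneg_nonneg)
    then show "is_arg_min (reg_risk eval_h L J lam) (\<lambda>_. True) g" if "g = f"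
      using that by (auto simp: is_arg_min_def not_less)
  qed
  have rm: "reg_minimizer eval_h L J lam = f"
    unfolding reg_minimizer_def arg_min_def argmin by simp
  have ex: "square_integrable J h \<and> (\<forall>x\<in>space MX. \<forall>y\<in>Y. h (x, y) \<in> subdifferential (L x y) (eval_h f x)) \<and>
      f = - (1 / (2 * lam)) *\<^sub>R integral_feature eval_h J h"
    using h(1,2) h(3)[of "(_, _)"] f by (auto simp: square_integrable_def int_eq spJ)
  \<comment> \<open>Every positive radius is treated, which serves both cases: \<open>a = B\<close>
    if \<open>B\<close> is positive, and all \<open>a\<close> if \<open>B = 0\<close>, where the
    supremum at radius 0 would range over the empty set.\<close>
  have sup: "sup_norm (space MX \<times> Y) h \<le> lip_const MX Y L a"
    if "\<forall>x\<in>space MX. \<forall>y\<in>Y. h (x, y) \<in> subdifferential (L x y) (eval_h f x)" "0 < a" for h a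
    unfolding sup_norm_def using that by (intro SUP_least) (auto intro!: norm_subgradient_le_lip_const)
  show ?thesis
    unfolding rm argmin Let_def using ex sup by blast
qed

end
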